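(* Let $a\in\mathbb{C}$ and $|\arg z|<\pi$, $z\ne 0$. For each non-negative integer $N$, write $$M^2(a, z) = z^{2a - 1} \left(\sum_{n=0}^{N-1} (-1)^n \frac{(1 - a)_{2n+1}}{n + 1 - a} \frac{1}{z^{2n+1}} + R_N^{(M)}(a, z) \right).$$ If $|\arg z| < \pi$ and $N+1 > \operatorname{Re}(a)$, then the remainder term $R_N^{(M)}(a, z)$ satisfies $$R_N^{(M)} (a,z) = 2\int_1^{+\infty} s^{2a - 2} R_N^{(\mathrm g)} (a,zs)\,ds$$ and $$\left| R_N^{(M)}(a, z) \right| \le \frac{\left| (1 - a)_{2N + 1} \right|}{N + 1 - \operatorname{Re}(a)} \frac{1}{|z|^{2N + 1}} \sup_{r \geq 1} \left| \Pi_{2N + 2 - a}(zr) \right|.$$ Furthermore, when $z > 0$, $a$ is real and $N+1 > a$, the remainder term $R_N^{(M)}(a, z)$ does not exceed the first omitted term $(-1)^N \frac{(1 - a)_{2N+1}}{N + 1 - a} \frac{1}{z^{2N+1}}$ in absolute value and is of the same sign as it.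
   Context: $\Gamma(a,z)$ is the (upper) incomplete gamma function (principal branch for $|\arg z|<\pi$), continued analytically in $z$ to the Riemann surface of the logarithm; it is entire in $a$. $(x)_n=x(x+1)\cdots(x+n-1)$, $(x)_0=1$. The auxiliary functions are $$\mathrm{f}(a, z) = \frac{1}{2i} e^{\frac{\pi}{2} i a} e^{-i z}\, \Gamma(a, z e^{-\frac{\pi}{2} i}) - \frac{1}{2i} e^{-\frac{\pi}{2} i a} e^{i z}\, \Gamma(a, z e^{\frac{\pi}{2} i}),$$ $$\mathrm{g}(a, z) = \frac{1}{2} e^{\frac{\pi}{2} i a} e^{-i z}\, \Gamma(a, z e^{-\frac{\pi}{2} i}) + \frac{1}{2} e^{-\frac{\pi}{2} i a} e^{i z}\, \Gamma(a, z e^{\frac{\pi}{2} i}),$$ where $ze^{\pm\pi i/2}$ denotes the point with argument $\arg z\pm\pi/2$. The square of the modulus function is $$M^2(a,z)=\mathrm{f}^2(a,z)+\mathrm{g}^2(a,z),$$ which is analytic in $z$ for $|\arg z|<\pi$ and entire in $a$ (for real $a<1$ and $z>0$ it equals $|\Gamma(a,ze^{-\pi i/2})|^2$). The apparent singularity of $\frac{(1-a)_{2n+1}}{n+1-a}$ at positive integer values of $a$ is removable, and the quotient is interpreted by its limiting value. The remainder $R_N^{(\mathrm g)}(a,z)$ is defined by $$\mathrm{g}(a, z) = z^{a - 1} \left( \sum_{n = 0}^{N - 1} (-1)^n \frac{(1 - a)_{2n + 1}}{z^{2n + 1}} + R_N^{(\mathrm g)}(a,z) \right).$$ For $\operatorname{Re}(p)>0$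 the basic terminant is $\Pi_p(z)=z^p\,\mathrm{f}(1-p,z)$. Powers of $z$ take their principal values. *)

theory Defs
  imports "HOL-Complex_Analysis.Complex_Analysis"
begin

section \<open>The incomplete gamma function on the Riemann surface of the logarithm\<close>

text \<open>
  A point of the Riemann surface of the logarithm is given by its logarithm
  \<open>w\<close>, i.e. \<open>w\<close> stands for the point of modulus \<open>exp (Re w)\<close> and argument \<open>Im w\<close>.
  The value at that point of the continuation of
  \<open>\<Gamma>(a,z) = \<integral>\<^sub>z\<^sup>\<infinity> t\<^bsup>a-1\<^esup> e\<^bsup>-t\<^esup> dt\<close>
  is the integral along a path on the surface from \<open>w\<close> to the point \<open>1\<close> of the principal
  sheet, followed by the positive real axis.  The first piece is written with
  \<open>t = exp u\<close>, \<open>u\<close> running from \<open>w\<close> to \<open>0\<close>, so that \<open>t\<^bsup>a-1\<^esup> e\<^bsup>-t\<^esup> dt\<close>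
  becomes \<open>exp (a u - exp u) du\<close>.
  The principal branch is the value at \<open>w = Ln z\<close>.
\<close>

definition inc_Gamma_log :: "complex \<Rightarrow> complex \<Rightarrow> complex" where
  "inc_Gamma_log a w =
     contour_integral (linepath w 0) (\<lambda>u. exp (a * u - exp u)) +
     integral {1..} (\<lambda>t. of_real t powr (a - 1) * exp (- of_real t))"

text \<open>The following two facts determine the function: it is entire in \<open>w\<close>, and over the
  positive real axis of the principal sheet it is the usual integral.\<close>

lemma has_field_derivative_inc_Gamma_log:
  "(inc_Gamma_log a has_field_derivative - exp (a * w - exp w)) (at w)"
proof -
  have "(\<lambda>u. exp (a * u - exp u)) holomorphic_on UNIV"
    by (intro holomorphic_intros)
  then obtain g where g: "\<And>x. (g has_field_derivative exp (a * x - exp x)) (at x)"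
    using holomorphic_convex_primitive'[of UNIV "\<lambda>u. exp (a * u - exp u)"] by auto
  have "contour_integral (linepath v 0) (\<lambda>u. exp (a * u - exp u)) = g 0 - g v" for v
    using contour_integral_primitive[of UNIV g "\<lambda>u. exp (a * u - exp u)" "linepath v 0"] g
    by (auto intro!: contour_integral_unique)
  then have eq: "inc_Gamma_log a = (\<lambda>v. g 0 - g v +
      integral {1..} (\<lambda>t. of_real t powr (a - 1) * exp (- of_real t)))"
    by (simp add: inc_Gamma_log_def fun_eq_iff)
  show ?thesis
    unfolding eq by (auto intro!: derivative_eq_intros g)
qed

lemma inc_Gamma_log_integrable:
  "(\<lambda>t. of_real t powr (a - 1) * exp (- of_real t) :: complex) absolutely_integrable_on {1..}"
proof -
  define p where "p = max 1 (Re a)"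
  let ?G = "\<lambda>t. complex_of_real t powr (of_real p - 1) / of_real (exp t)"
  have "?G absolutely_integrable_on {0<..}"
    using absolutely_integrable_Gamma_integral'[of "of_real p"] by (simp add: p_def)
  then have "?G absolutely_integrable_on {1..}"
    by (rule set_integrable_subset) auto
  then have "(\<lambda>t. norm (?G t)) integrable_on {1..}"
    by (simp add: absolutely_integrable_on_def)
  moreover have "continuous_on {1..} (\<lambda>t. of_real t powr (a - 1) * exp (- of_real t) :: complex)"
    by (intro continuous_intros) auto
  then have "(\<lambda>t. of_real t powr (a - 1) * exp (- of_real t) :: complex)
      \<in> borel_measurable (lebesgue_on {1..})"
    by (rule continuous_imp_measurable_on_sets_lebesgue) auto
  moreover have "norm (of_real t powr (a - 1) * exp (- of_real t) :: complex) \<le> norm (?G t)"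
    if "t \<in> {1..}" for t
  proof -
    have "t powr (Re a - 1) \<le> t powr (p - 1)"
      using that by (intro powr_mono) (auto simp: p_def)
    then show ?thesis
      using that
      by (simp add: norm_mult norm_divide norm_powr_real_powr exp_minus divide_simps)
  qed
  ultimately show ?thesis
    by (intro measurable_bounded_by_integrable_imp_absolutely_integrable) auto
qed

lemma inc_Gamma_log_of_real:
  assumes "x > 0"
  shows "((\<lambda>t. of_real t powr (a - 1) * exp (- of_real t))
            has_integral inc_Gamma_log a (of_real (ln x))) {x..}"
proof -
  let ?J = "\<lambda>t. of_real t powr (a - 1) * exp (- of_real t) :: complex"
  let ?G = "\<lambda>t. inc_Gamma_log a (of_real (ln t))"
  have FTC: "(?J has_integral ?G u - ?G v) {u..v}" if uv: "0 < u" "u \<le> v" for u v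
  proof -
    have "((\<lambda>t. - ?G t) has_vector_derivative ?J t) (at t within {u..v})" if "t \<in> {u..v}" for t
    proof -
      have t: "t > 0" using that uv by auto
      have "((\<lambda>t. complex_of_real (ln t)) has_vector_derivative of_real (1 / t)) (at t within {u..v})"
        using t by (auto intro!: derivative_eq_intros has_vector_derivative_of_real
            simp: has_real_derivative_iff_has_vector_derivative[symmetric] divide_inverse)
      from field_vector_diff_chain_within[OF this
          has_field_derivative_at_within[OF has_field_derivative_inc_Gamma_log]]
      have "(?G has_vector_derivative
          of_real (1 / t) * - exp (a * of_real (ln t) - exp (of_real (ln t)))) (at t within {u..v})"
        by (simp add: o_def)
      then have "((\<lambda>t. - ?G t) has_vector_derivative
          - (of_real (1 / t) * - exp (a * of_real (ln t) - exp (of_real (ln t))))) (at t within {u..v})"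
        by (rule has_vector_derivative_minus)
      moreover have e: "exp (complex_of_real (ln t)) = of_real t"
        using t by (metis exp_ln exp_of_real)
      have "of_real t powr (a - 1) = exp (a * of_real (ln t)) / complex_of_real t"
        using t by (simp add: powr_def Ln_of_real exp_diff ring_distribs e)
      then have "- (of_real (1 / t) * - exp (a * of_real (ln t) - exp (of_real (ln t)))) = ?J t"
        by (simp add: e exp_diff exp_minus divide_inverse)
      ultimately show ?thesis by simp
    qed
    from fundamental_theorem_of_calculus[OF uv(2) this] show ?thesis by simp
  qed
  have base: "(?J has_integral ?G 1) {1..}"
    using set_lebesgue_integral_eq_integral(1)[OF inc_Gamma_log_integrable[of a]]
    by (simp add: inc_Gamma_log_def integrable_integral)
  show ?thesis
  proof (cases "x \<le> 1")
    case True
    have "{x..1} \<inter> {1..} = {1}" using True by auto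
    then have "(?J has_integral (?G x - ?G 1) + ?G 1) ({x..1} \<union> {1..})"
      using FTC[of x 1] base assms True by (intro has_integral_Un) auto
    moreover have "{x..1} \<union> {1..} = {x..}" using True by auto
    ultimately show ?thesis by simp
  next
    case False
    have int: "?J integrable_on {x..}"
      using set_integrable_subset[OF inc_Gamma_log_integrable[of a], of "{x..}"] False
      by (auto intro: set_lebesgue_integral_eq_integral)
    have "{1..x} \<inter> {x..} = {x}" using False by auto
    then have "(?J has_integral (?G 1 - ?G x) + integral {x..} ?J) ({1..x} \<union> {x..})"
      using FTC[of 1 x] integrable_integral[OF int] False by (intro has_integral_Un) auto
    moreover have "{1..x} \<union> {x..} = {1..}" using False by auto
    ultimately have "(?J has_integral (?G 1 - ?G x) + integral {x..} ?J) {1..}" by simp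
    from has_integral_unique[OF this base] have "integral {x..} ?J = ?G x"
      by (simp add: algebra_simps)
    with integrable_integral[OF int] show ?thesis by (simp only:)
  qed
qed


section \<open>Auxiliary functions, modulus function and terminant\<close>

text \<open>All functions of \<open>z\<close> below are meant on \<open>z \<noteq> 0\<close>, \<open>\<bar>Arg z\<bar> < pi\<close>;
  adding \<open>\<plusminus> \<i> pi / 2\<close> to \<open>Ln z\<close> shifts the argument on the Riemann surface, which may leave
  the principal sheet.\<close>

definition aux_f :: "complex \<Rightarrow> complex \<Rightarrow> complex" where
  "aux_f a z =
     1 / (2 * \<i>) * exp (of_real pi / 2 * \<i> * a) * exp (- \<i> * z)
        * inc_Gamma_log a (Ln z - of_real pi / 2 * \<i>)
   - 1 / (2 * \<i>) * exp (- (of_real pi / 2 * \<i> * a)) * exp (\<i> * z)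
        * inc_Gamma_log a (Ln z + of_real pi / 2 * \<i>)"

definition aux_g :: "complex \<Rightarrow> complex \<Rightarrow> complex" where
  "aux_g a z =
     1 / 2 * exp (of_real pi / 2 * \<i> * a) * exp (- \<i> * z)
        * inc_Gamma_log a (Ln z - of_real pi / 2 * \<i>)
   + 1 / 2 * exp (- (of_real pi / 2 * \<i> * a)) * exp (\<i> * z)
        * inc_Gamma_log a (Ln z + of_real pi / 2 * \<i>)"

definition modulus_sq :: "complex \<Rightarrow> complex \<Rightarrow> complex" where
  "modulus_sq a z = (aux_f a z)\<^sup>2 + (aux_g a z)\<^sup>2"

definition terminant :: "complex \<Rightarrow> complex \<Rightarrow> complex" where
  "terminant p z = z powr p * aux_f (1 - p) z"


section \<open>Remainder terms\<close>

definition remainder_g :: "nat \<Rightarrow> complex \<Rightarrow> complex \<Rightarrow> complex" where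
  "remainder_g N a z =
     aux_g a z / z powr (a - 1)
     - (\<Sum>n<N. (-1) ^ n * (pochhammer (1 - a) (2 * n + 1) / z ^ (2 * n + 1)))"

lemma aux_g_expansion:
  assumes "z \<noteq> 0"
  shows "aux_g a z = z powr (a - 1) *
    ((\<Sum>n<N. (-1) ^ n * (pochhammer (1 - a) (2 * n + 1) / z ^ (2 * n + 1))) + remainder_g N a z)"
  using assms by (simp add: remainder_g_def)

text \<open>The quotient \<open>(1-a)\<^bsub>2n+1\<^esub> / (n+1-a)\<close>, with its limiting value at \<open>a = n + 1\<close>.\<close>

definition M_coeff :: "nat \<Rightarrow> complex \<Rightarrow> complex" where
  "M_coeff n a =
     (if a = of_nat (n + 1)
      then Lim (at a) (\<lambda>b. pochhammer (1 - b) (2 * n + 1) / (of_nat n + 1 - b))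
      else pochhammer (1 - a) (2 * n + 1) / (of_nat n + 1 - a))"

lemma M_coeff_eq_prod: "M_coeff n a = (\<Prod>k\<in>{..2 * n} - {n}. of_nat k + 1 - a)"
proof -
  have poch: "pochhammer (1 - b) (2 * n + 1) / (of_nat n + 1 - b)
      = (\<Prod>k\<in>{..2 * n} - {n}. of_nat k + 1 - b)" if "b \<noteq> of_nat (n + 1)" for b :: complex
  proof -
    have "pochhammer (1 - b) (2 * n + 1) = (\<Prod>k\<in>{..2 * n}. of_nat k + 1 - b)"
      by (simp add: pochhammer_prod atLeast0LessThan lessThan_Suc_atMost algebra_simps
          del: prod.lessThan_Suc)
    also have "\<dots> = (of_nat n + 1 - b) * (\<Prod>k\<in>{..2 * n} - {n}. of_nat k + 1 - b)"
      by (subst prod.remove[of _ n]) auto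
    finally show ?thesis using that by (auto simp: add.commute)
  qed
  show ?thesis
  proof (cases "a = of_nat (n + 1)")
    case True
    have "((\<lambda>b. \<Prod>k\<in>{..2 * n} - {n}. of_nat k + 1 - b) \<longlongrightarrow>
        (\<Prod>k\<in>{..2 * n} - {n}. of_nat k + 1 - a)) (at a)"
      by (intro tendsto_intros)
    moreover have "eventually (\<lambda>b. (\<Prod>k\<in>{..2 * n} - {n}. of_nat k + 1 - b) =
        pochhammer (1 - b) (2 * n + 1) / (of_nat n + 1 - b)) (at a)"
      using True poch by (auto simp: eventually_at_filter)
    ultimately have "((\<lambda>b. pochhammer (1 - b) (2 * n + 1) / (of_nat n + 1 - b)) \<longlongrightarrow>
        (\<Prod>k\<in>{..2 * n} - {n}. of_nat k + 1 - a)) (at a)"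
      by (rule Lim_transform_eventually)
    then show ?thesis
      using True tendsto_Lim[OF at_neq_bot] by (auto simp: M_coeff_def)
  next
    case False
    then show ?thesis using poch[OF False] by (simp add: M_coeff_def)
  qed
qed

definition remainder_M :: "nat \<Rightarrow> complex \<Rightarrow> complex \<Rightarrow> complex" where
  "remainder_M N a z =
     modulus_sq a z / z powr (2 * a - 1)
     - (\<Sum>n<N. (-1) ^ n * M_coeff n a * (1 / z ^ (2 * n + 1)))"

lemma modulus_sq_expansion:
  assumes "z \<noteq> 0"
  shows "modulus_sq a z = z powr (2 * a - 1) *
    ((\<Sum>n<N. (-1) ^ n * M_coeff n a * (1 / z ^ (2 * n + 1))) + remainder_M N a z)"
  using assms by (simp add: remainder_M_def)

end

theory Submission
  imports Defs "HOL-Real_Asymp.Real_Asymp"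
begin

text \<open>
  Put \<open>h\<^sub>\<plusminus> = g \<plusminus> \<i> f\<close>. Each of these is a constant times \<open>e\<^bsup>\<zeta>\<^esup> \<Gamma>(a,\<zeta>)\<close> at
  \<open>\<zeta> = z e\<^bsup>\<mp>\<pi>\<i>/2\<^esup>\<close>, and \<open>M\<^sup>2 = h\<^sub>+ h\<^sub>-\<close>. From \<open>h\<^sub>\<plusminus>' = \<mp>\<i> h\<^sub>\<plusminus> - z\<^bsup>a-1\<^esup>\<close> follows
  \<open>(M\<^sup>2)' = - 2 z\<^bsup>a-1\<^esup> g\<close>. Removing the leading terms of the expansions on both sides shows that
  \<open>s\<^bsup>2a-1\<^esup> R\<^sup>M\<^sub>N(a,zs)\<close> has the derivative \<open>- 2 s\<^bsup>2a-2\<^esup> R\<^sup>g\<^sub>N(a,zs)\<close> in \<open>s\<close>, and the integral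
  representation is the fundamental theorem of calculus on \<open>[1,\<infinity>)\<close>, provided that the integral converges
  and the primitive vanishes at infinity.
  
  Convergence rests on the recurrence \<open>\<Gamma>(a+1,\<zeta>) = a \<Gamma>(a,\<zeta>) + \<zeta>\<^bsup>a\<^esup> e\<^bsup>-\<zeta>\<^esup>\<close>. It gives
  \<open>g(a,z) = (1-a) f(a-1,z)\<close> and a similar formula for \<open>f\<close>, hence the exact identity
  \<open>R\<^sup>g\<^sub>N(a,z) = (-1)\<^sup>N (1-a)\<^bsub>2N+1\<^esub> z\<^bsup>-2N-1\<^esup> \<Pi>\<^bsub>2N+2-a\<^esub>(z)\<close> (\<open>remainder_g_eq_terminant\<close>), and
  terminants are bounded on rays with \<open>\<bar>arg z\<bar> < \<pi>\<close> (\<open>terminant_bounded_on_ray\<close>). The boundedness comes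
  from \<open>e\<^bsup>\<zeta>\<^esup> \<Gamma>(a,\<zeta>) = O(\<bar>\<zeta>\<bar>\<^bsup>Re a - 1\<^esup>)\<close> on rays with \<open>\<bar>arg \<zeta>\<bar> < 3\<pi>/2\<close>
  (\<open>scaled_inc_Gamma_decay\<close>): elementary estimates of the integrand along arcs and rays lose one power of
  \<open>\<zeta>\<close>, and the recurrence regains it.
  
  That the primitive vanishes at infinity (\<open>remainder_M_weighted_tendsto_0\<close>) is clear for \<open>N = 0\<close>, where
  \<open>Re a < 1\<close> and \<open>h\<^sub>+ h\<^sub>-\<close> tends to \<open>0\<close>. The recurrence yields
  \<open>z\<^sup>2 R\<^sup>M\<^bsub>N+1\<^esub>(a+1,z) = a\<^sup>2 R\<^sup>M\<^sub>N(a,z) + 2 a R\<^sup>g\<^sub>N(a,z)\<close> (\<open>remainder_M_plus1\<close>), which reduces all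
  other cases to this one.
  
  The bound follows by inserting the formula for \<open>R\<^sup>g\<^sub>N\<close> into the integral. In the real case it
  remains to see that \<open>0 < \<Pi>\<^sub>p(x) < 1\<close> for \<open>p > 0\<close>. Here \<open>y(x) = x\<^bsup>-p\<^esup> \<Pi>\<^sub>p(x)\<close> solves
  \<open>y'' + y = x\<^bsup>-p\<^esup>\<close> and tends to \<open>0\<close>; since the right-hand side decreases, so do the values of \<open>y\<close>
  from one period \<open>2\<pi>\<close> to the next, and they are positive. The upper bound is positivity again, because
  \<open>1 - \<Pi>\<^sub>p(x) = p (p+1) x\<^bsup>-2\<^esup> \<Pi>\<^bsub>p+2\<^esub>(x)\<close>.
\<close>

section \<open>Growth of the scaled incomplete gamma function\<close>

text \<open>
  At the point \<open>\<zeta> = exp w\<close> of the surface this is \<open>e\<^bsup>\<zeta>\<^esup> \<Gamma>(a,\<zeta>)\<close>. The factor \<open>e\<^bsup>\<zeta>\<^esup>\<close>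
  cancels the exponential behaviour, so that only powers of \<open>\<zeta>\<close> remain in the recurrence in \<open>a\<close> and
  in the growth estimates.
\<close>

definition scaled_inc_Gamma :: "complex \<Rightarrow> complex \<Rightarrow> complex" where
  "scaled_inc_Gamma a w = exp (exp w) * inc_Gamma_log a w"

lemma has_field_derivative_scaled_inc_Gamma:
  "(scaled_inc_Gamma a has_field_derivative exp w * scaled_inc_Gamma a w - exp (a * w)) (at w)"
proof -
  have "((\<lambda>w. exp (exp w) * inc_Gamma_log a w) has_field_derivative
      exp (exp w) * exp w * inc_Gamma_log a w + - exp (a * w - exp w) * exp (exp w)) (at w)"
    by (auto intro!: derivative_eq_intros has_field_derivative_inc_Gamma_log)
  moreover have "exp (exp w) * exp w * inc_Gamma_log a w + - exp (a * w - exp w) * exp (exp w) =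
      exp w * scaled_inc_Gamma a w - exp (a * w)"
    by (simp add: scaled_inc_Gamma_def exp_diff algebra_simps)
  moreover have "scaled_inc_Gamma a = (\<lambda>w. exp (exp w) * inc_Gamma_log a w)"
    by (simp add: fun_eq_iff scaled_inc_Gamma_def)
  ultimately show ?thesis by (simp only:)
qed

lemma tendsto_inc_Gamma_log_at_top:
  "((\<lambda>u. inc_Gamma_log a (of_real u)) \<longlongrightarrow> 0) at_top"
proof -
  let ?J = "\<lambda>t. of_real t powr (a - 1) * exp (- of_real t) :: complex"
  have int: "set_integrable lebesgue {1..} ?J"
    by (rule inc_Gamma_log_integrable)
  have sub: "set_integrable lebesgue {1..x} ?J" for x
    by (rule set_integrable_subset[OF int]) auto
  have "((\<lambda>x. set_lebesgue_integral lebesgue {1..x} ?J) \<longlongrightarrow>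
      set_lebesgue_integral lebesgue {1..} ?J) at_top"
    by (rule tendsto_set_lebesgue_integral_at_top[OF _ int]) auto
  then have lim: "((\<lambda>x. integral {1..x} ?J) \<longlongrightarrow> integral {1..} ?J) at_top"
    using set_lebesgue_integral_eq_integral(2)[OF int] set_lebesgue_integral_eq_integral(2)[OF sub]
    by simp
  have eq: "integral {1..} ?J - integral {1..x} ?J = inc_Gamma_log a (of_real (ln x))" if "x \<ge> 1" for x
  proof -
    have "{1..x} \<inter> {x..} = {x}" using that by auto
    then have "(?J has_integral integral {1..x} ?J + inc_Gamma_log a (of_real (ln x))) ({1..x} \<union> {x..})"
      using set_lebesgue_integral_eq_integral(1)[OF sub] inc_Gamma_log_of_real[of x a] that
      by (intro has_integral_Un integrable_integral) auto
    moreover have "{1..x} \<union> {x..} = {1..}" using that by auto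
    ultimately show ?thesis by (simp add: integral_unique)
  qed
  have "((\<lambda>x. integral {1..} ?J - integral {1..x} ?J) \<longlongrightarrow> 0) at_top"
    using tendsto_diff[OF tendsto_const lim, of "integral {1..} ?J"] by simp
  then have "((\<lambda>x. inc_Gamma_log a (of_real (ln x))) \<longlongrightarrow> 0) at_top"
    by (rule Lim_transform_eventually) (rule eventually_mono[OF eventually_ge_at_top[of 1] eq])
  from filterlim_compose[OF this exp_at_top] show ?thesis by simp
qed

text \<open>
  This is \<open>\<Gamma>(a+1,\<zeta>) = a \<Gamma>(a,\<zeta>) + \<zeta>\<^bsup>a\<^esup> e\<^bsup>-\<zeta>\<^esup>\<close> on the whole surface: the difference of the two
  sides has derivative \<open>0\<close> and tends to \<open>0\<close> along the positive real axis.
\<close>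

lemma scaled_inc_Gamma_plus1:
  "scaled_inc_Gamma (a + 1) w = a * scaled_inc_Gamma a w + exp (a * w)"
proof -
  define D where "D = (\<lambda>w. inc_Gamma_log (a + 1) w - a * inc_Gamma_log a w - exp (a * w - exp w))"
  have "(D has_field_derivative 0) (at w)" for w
    unfolding D_def
    by (rule derivative_eq_intros has_field_derivative_inc_Gamma_log refl)+
      (simp add: exp_diff exp_add field_simps)
  then have const: "D w = D v" for w v
    using has_field_derivative_zero_constant[of UNIV D] by (metis UNIV_I convex_UNIV)
  have "((\<lambda>u. exp (Re a * u - exp u)) \<longlongrightarrow> 0) at_top" by real_asymp
  moreover have "exp (Re a * u - exp u) = norm (exp (a * of_real u - exp (of_real u)))" for u
    by (simp add: Re_exp)
  ultimately have "((\<lambda>u. norm (exp (a * of_real u - exp (of_real u)))) \<longlongrightarrow> 0) at_top"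
    by (simp only:)
  then have "((\<lambda>u. exp (a * of_real u - exp (of_real u))) \<longlongrightarrow> 0) at_top"
    by (rule tendsto_norm_zero_cancel)
  then have "((\<lambda>u. D (of_real u)) \<longlongrightarrow> 0 - a * 0 - 0) at_top"
    unfolding D_def by (intro tendsto_intros tendsto_inc_Gamma_log_at_top)
  moreover have "(\<lambda>u. D (of_real u)) = (\<lambda>u::real. D w)"
    using const by blast
  ultimately have "((\<lambda>u::real. D w) \<longlongrightarrow> 0) at_top"
    by simp
  then have "D w = 0"
    by (simp add: tendsto_const_iff)
  then have "exp (exp w) * D w = 0" by simp
  then show ?thesis
    by (simp add: D_def scaled_inc_Gamma_def algebra_simps exp_diff)
qed

lemma norm_exp_log_plane:
  "norm (exp (a * Complex u \<theta> - exp (Complex u \<theta>))) = exp (Re a * u - Im a * \<theta> - exp u * cos \<theta>)"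
  by (simp add: Re_exp)

text \<open>
  The majorant \<open>exp (Re a * u - exp u)\<close> is the modulus of the derivative, and for large \<open>u\<close> its own
  derivative is at most its negative. So the total variation of the function on \<open>[u, \<infinity>)\<close> is at most
  the majorant at \<open>u\<close>, and the function vanishes at infinity.
\<close>

lemma inc_Gamma_log_real_bound:
  "\<forall>\<^sub>F u in at_top. norm (inc_Gamma_log a (of_real u)) \<le> exp (Re a * u - exp u)"
proof -
  let ?G = "\<lambda>u. inc_Gamma_log a (of_real u)"
  let ?y = "\<lambda>u. exp (Re a * u - exp u)"
  have diff: "norm (?G v - ?G u) \<le> ?y u - ?y v" if uv: "exp u \<ge> Re a + 1" "u < v" for u v
  proof -
    have "norm (?G v - ?G u) \<le> - ?y v - - ?y u"
    proof (rule differentiable_bound_general[OF uv(2)])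
      fix t assume t: "u < t" "t < v"
      show "(?G has_vector_derivative - exp (a * of_real t - exp (of_real t))) (at t)"
        by (rule has_vector_derivative_real_field has_field_derivative_inc_Gamma_log)+
      show "((\<lambda>u. - ?y u) has_vector_derivative (exp t - Re a) * ?y t) (at t)"
        unfolding has_real_derivative_iff_has_vector_derivative[symmetric]
        by (auto intro!: derivative_eq_intros simp: algebra_simps)
      have "exp t - Re a \<ge> 1" using uv(1) t(1) by (smt (verit) exp_less_mono)
      then have "1 * ?y t \<le> (exp t - Re a) * ?y t" by (intro mult_right_mono) auto
      then show "norm (- exp (a * of_real t - exp (of_real t))) \<le> (exp t - Re a) * ?y t"
        by (simp add: Re_exp)
    next
      show "continuous_on {u..v} ?G"
        by (intro continuous_at_imp_continuous_on ballI has_vector_derivative_continuous)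
          (rule has_vector_derivative_real_field has_field_derivative_inc_Gamma_log)+
    qed (intro continuous_intros)
    then show ?thesis by simp
  qed
  have "norm (?G u) \<le> ?y u" if u: "exp u \<ge> Re a + 1" for u
  proof -
    have "((\<lambda>v. norm (?G v - ?G u)) \<longlongrightarrow> norm (0 - ?G u)) at_top"
      by (intro tendsto_intros tendsto_inc_Gamma_log_at_top)
    moreover have "\<forall>\<^sub>F v in at_top. norm (?G v - ?G u) \<le> ?y u"
      using eventually_gt_at_top[of u]
      by eventually_elim (smt (verit) diff[OF u] exp_gt_zero)
    ultimately show ?thesis
      using tendsto_upperbound[of "\<lambda>v. norm (?G v - ?G u)" _ at_top "?y u"] by simp
  qed
  moreover have "\<forall>\<^sub>F u in at_top. exp u \<ge> Re a + 1" by real_asymp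
  ultimately show ?thesis by (rule eventually_mono[rotated])
qed

text \<open>
  On a ray in the left half-plane the integrand grows, so the integral from a fixed point is dominated
  by its upper end. The majorant is compared with its own derivative, which is at least as large for large \<open>u\<close>.
\<close>

lemma inc_Gamma_log_growth_left:
  assumes "cos \<phi> < 0"
  shows "\<exists>C. \<forall>\<^sub>F u in at_top. norm (inc_Gamma_log a (Complex u \<phi>)) \<le> C * exp (Re a * u - exp u * cos \<phi>)"
proof -
  let ?G = "\<lambda>u. inc_Gamma_log a (Complex u \<phi>)"
  let ?y = "\<lambda>u. exp (Re a * u - exp u * cos \<phi>)"
  \<comment> \<open>The modulus of the derivative is \<open>K\<close> times the majorant.\<close>
  define K where "K = exp (- Im a * \<phi>)"
  have K: "K > 0" by (simp add: K_def)
  have "\<forall>\<^sub>F u in at_top. Re a + - cos \<phi> * exp u \<ge> 1"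
  proof -
    define c where "c = - cos \<phi>"
    have "c > 0" using assms by (simp add: c_def)
    then have "\<forall>\<^sub>F u in at_top. Re a + c * exp u \<ge> 1" by real_asymp
    then show ?thesis by (simp add: c_def)
  qed
  then obtain u0 where u0: "Re a + - cos \<phi> * exp u \<ge> 1" if "u \<ge> u0" for u
    by (auto simp: eventually_at_top_linorder)
  have dG: "(?G has_vector_derivative - exp (a * Complex t \<phi> - exp (Complex t \<phi>))) (at t)" for t
  proof -
    have "((\<lambda>u. Complex u \<phi>) has_vector_derivative 1) (at t)"
      unfolding Complex_eq by (auto intro!: derivative_eq_intros)
    from field_vector_diff_chain_at[OF this has_field_derivative_inc_Gamma_log]
    show ?thesis by (simp add: o_def)
  qed
  have bound: "norm (?G u) \<le> (norm (?G u0) / ?y u0 + K) * ?y u" if u: "u > u0" for u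
  proof -
    have "norm (?G u - ?G u0) \<le> K * ?y u - K * ?y u0"
    proof (rule differentiable_bound_general[OF u])
      fix t assume t: "u0 < t" "t < u"
      show "(?G has_vector_derivative - exp (a * Complex t \<phi> - exp (Complex t \<phi>))) (at t)"
        by (rule dG)
      show "((\<lambda>u. K * ?y u) has_vector_derivative K * ((Re a + - cos \<phi> * exp t) * ?y t)) (at t)"
        unfolding has_real_derivative_iff_has_vector_derivative[symmetric]
        by (auto intro!: derivative_eq_intros simp: algebra_simps)
      have "1 * ?y t \<le> (Re a + - cos \<phi> * exp t) * ?y t" using u0[of t] t by (intro mult_right_mono) auto
      then have "K * ?y t \<le> K * ((Re a + - cos \<phi> * exp t) * ?y t)"
        using K by simp
      moreover have "norm (- exp (a * Complex t \<phi> - exp (Complex t \<phi>))) = K * ?y t"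
        unfolding norm_minus_cancel norm_exp_log_plane by (simp add: K_def algebra_simps flip: exp_add)
      ultimately show "norm (- exp (a * Complex t \<phi> - exp (Complex t \<phi>))) \<le> K * ((Re a + - cos \<phi> * exp t) * ?y t)"
        by simp
    next
      show "continuous_on {u0..u} ?G"
        by (intro continuous_at_imp_continuous_on ballI has_vector_derivative_continuous[OF dG])
    qed (intro continuous_intros)
    then have "norm (?G u) \<le> norm (?G u0) + K * ?y u - K * ?y u0"
      by (smt (verit) norm_triangle_sub)
    moreover have "?y u0 \<le> ?y u"
    proof (rule DERIV_nonneg_imp_nondecreasing[OF less_imp_le[OF u]])
      fix t assume t: "u0 \<le> t"
      have "(?y has_real_derivative (Re a + - cos \<phi> * exp t) * ?y t) (at t)"
        by (auto intro!: derivative_eq_intros simp: algebra_simps)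
      moreover have "(Re a + - cos \<phi> * exp t) * ?y t \<ge> 0" using u0[OF t] by simp
      ultimately show "\<exists>y. (?y has_real_derivative y) (at t) \<and> 0 \<le> y" by blast
    qed
    then have "norm (?G u0) / ?y u0 * ?y u0 \<le> norm (?G u0) / ?y u0 * ?y u"
      by (intro mult_left_mono) auto
    moreover have "K * ?y u0 \<ge> 0" using K by simp
    ultimately show ?thesis unfolding distrib_right by simp
  qed
  show ?thesis
    by (rule exI, rule eventually_mono[OF eventually_gt_at_top bound])
qed

text \<open>
  The value at argument \<open>\<phi>\<close> is reached from the positive real axis along a circular arc, a vertical
  segment in the logarithmic plane. Since \<open>cos\<close> decreases on \<open>[0, pi]\<close>, the integrand is largest at
  the end of the arc, up to the bounded factor \<open>exp (- Im a * \<theta>)\<close>.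
\<close>

lemma inc_Gamma_log_growth_principal:
  assumes "\<bar>\<phi>\<bar> \<le> pi"
  shows "\<exists>C. \<forall>\<^sub>F u in at_top. norm (inc_Gamma_log a (Complex u \<phi>)) \<le> C * exp (Re a * u - exp u * cos \<phi>)"
proof -
  let ?y = "\<lambda>u. exp (Re a * u - exp u * cos \<phi>)"
  have vert: "norm (inc_Gamma_log a (Complex u \<phi>) - inc_Gamma_log a (Complex u 0))
      \<le> exp (\<bar>Im a\<bar> * pi) * ?y u * norm (Complex u \<phi> - Complex u 0)" for u
  proof (rule field_differentiable_bound[where S = "{w. Re w \<le> u} \<inter> {w. Re w \<ge> u} \<inter> {w. Im w \<le> \<bar>\<phi>\<bar>} \<inter> {w. Im w \<ge> - \<bar>\<phi>\<bar>}"])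
    show "convex ({w. Re w \<le> u} \<inter> {w. Re w \<ge> u} \<inter> {w. Im w \<le> \<bar>\<phi>\<bar>} \<inter> {w. Im w \<ge> - \<bar>\<phi>\<bar>})"
      by (intro convex_Int convex_halfspace_Im_ge convex_halfspace_Im_le convex_halfspace_Re_ge convex_halfspace_Re_le)
  next
    fix w assume w: "w \<in> {w. Re w \<le> u} \<inter> {w. Re w \<ge> u} \<inter> {w. Im w \<le> \<bar>\<phi>\<bar>} \<inter> {w. Im w \<ge> - \<bar>\<phi>\<bar>}"
    then have w_eq: "w = Complex u (Im w)" by (simp add: complex_eq_iff)
    have "cos \<bar>\<phi>\<bar> \<le> cos \<bar>Im w\<bar>"
      using w assms by (intro cos_monotone_0_pi_le) auto
    then have "exp u * cos \<phi> \<le> exp u * cos (Im w)" by simp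
    moreover have "- Im a * Im w \<le> \<bar>Im a\<bar> * pi"
    proof -
      have "- Im a * Im w \<le> \<bar>Im a\<bar> * \<bar>Im w\<bar>" by (metis abs_ge_self abs_minus_cancel abs_mult)
      also have "\<dots> \<le> \<bar>Im a\<bar> * pi" using w assms by (intro mult_left_mono) auto
      finally show ?thesis .
    qed
    ultimately have "exp (Re a * u - Im a * Im w - exp u * cos (Im w)) \<le> exp (\<bar>Im a\<bar> * pi + (Re a * u - exp u * cos \<phi>))"
      unfolding exp_le_cancel_iff by linarith
    then show "norm (- exp (a * w - exp w)) \<le> exp (\<bar>Im a\<bar> * pi) * ?y u"
      using norm_exp_log_plane[of a u "Im w"] w_eq by (simp only: norm_minus_cancel exp_add)
  qed (auto intro: has_field_derivative_at_within[OF has_field_derivative_inc_Gamma_log])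
  have "\<forall>\<^sub>F u in at_top. norm (inc_Gamma_log a (Complex u \<phi>)) \<le> (exp (\<bar>Im a\<bar> * pi) * \<bar>\<phi>\<bar> + 1) * ?y u"
    using inc_Gamma_log_real_bound[of a]
  proof eventually_elim
    fix u :: real assume u: "norm (inc_Gamma_log a (of_real u)) \<le> exp (Re a * u - exp u)"
    have "exp u * cos \<phi> \<le> exp u * 1" by (intro mult_left_mono) auto
    then have "exp (Re a * u - exp u) \<le> ?y u" by simp
    moreover have "norm (Complex u \<phi> - Complex u 0) = \<bar>\<phi>\<bar>" by (simp add: cmod_def)
    moreover have "Complex u 0 = of_real u" by (simp add: complex_eq_iff)
    ultimately have "norm (inc_Gamma_log a (Complex u \<phi>)) \<le> exp (\<bar>Im a\<bar> * pi) * ?y u * \<bar>\<phi>\<bar> + ?y u"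
      using vert[of u] u by (smt (verit) norm_triangle_sub)
    then show "norm (inc_Gamma_log a (Complex u \<phi>)) \<le> (exp (\<bar>Im a\<bar> * pi) * \<bar>\<phi>\<bar> + 1) * ?y u"
      by (simp add: algebra_simps)
  qed
  then show ?thesis by blast
qed

text \<open>
  The two preceding estimates together cover the open sector of half-angle \<open>3 pi / 2\<close>. The exponent is
  one larger than the true order of growth; the recurrence in \<open>a\<close> repairs this in the next lemma.
\<close>

lemma scaled_inc_Gamma_growth:
  assumes "\<bar>\<phi>\<bar> < 3 * pi / 2"
  shows "\<exists>C. \<forall>\<^sub>F u in at_top. norm (scaled_inc_Gamma a (Complex u \<phi>)) \<le> C * exp (Re a * u)"
proof -
  have "\<exists>C. \<forall>\<^sub>F u in at_top. norm (inc_Gamma_log a (Complex u \<phi>)) \<le> C * exp (Re a * u - exp u * cos \<phi>)"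
  proof (cases "\<bar>\<phi>\<bar> \<le> pi")
    case False
    have "cos (\<bar>\<phi>\<bar> - pi) > 0" using False assms by (intro cos_gt_zero_pi) auto
    then have "cos \<phi> < 0" by simp
    then show ?thesis by (rule inc_Gamma_log_growth_left)
  qed (rule inc_Gamma_log_growth_principal)
  then obtain C where C: "\<forall>\<^sub>F u in at_top. norm (inc_Gamma_log a (Complex u \<phi>)) \<le> C * exp (Re a * u - exp u * cos \<phi>)"
    by blast
  have "\<forall>\<^sub>F u in at_top. norm (scaled_inc_Gamma a (Complex u \<phi>)) \<le> C * exp (Re a * u)"
    using C
  proof eventually_elim
    fix u assume "norm (inc_Gamma_log a (Complex u \<phi>)) \<le> C * exp (Re a * u - exp u * cos \<phi>)"
    then have "exp (exp u * cos \<phi>) * norm (inc_Gamma_log a (Complex u \<phi>))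
        \<le> exp (exp u * cos \<phi>) * (C * exp (Re a * u - exp u * cos \<phi>))" by (intro mult_left_mono) auto
    then show "norm (scaled_inc_Gamma a (Complex u \<phi>)) \<le> C * exp (Re a * u)"
      by (simp add: scaled_inc_Gamma_def norm_mult Re_exp exp_diff)
  qed
  then show ?thesis by blast
qed

text \<open>
  The recurrence writes the function with parameter \<open>a\<close> as \<open>\<zeta>\<^bsup>a-1\<^esup>\<close> plus a multiple of the function
  with parameter \<open>a - 1\<close>, for which the crude bound is already of order \<open>Re a - 1\<close>. Compactness
  extends the bound from large \<open>s\<close> to all \<open>s \<ge> 1\<close>.
\<close>

lemma scaled_inc_Gamma_decay:
  assumes "\<bar>Im w\<bar> < 3 * pi / 2"
  shows "\<exists>C. \<forall>s\<ge>1. norm (scaled_inc_Gamma a (w + of_real (ln s))) \<le> C * s powr (Re a - 1)"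
proof -
  let ?H = "\<lambda>a s. scaled_inc_Gamma a (w + of_real (ln s))"
  obtain C where C: "\<forall>\<^sub>F u in at_top. norm (scaled_inc_Gamma (a - 1) (Complex u (Im w))) \<le> C * exp ((Re a - 1) * u)"
    using scaled_inc_Gamma_growth[OF assms, of "a - 1"] by auto
  have "filterlim (\<lambda>s. Re w + ln s) at_top at_top" by real_asymp
  from filterlim_iff[THEN iffD1, OF this, rule_format, OF C]
  have C': "\<forall>\<^sub>F s in at_top. norm (scaled_inc_Gamma (a - 1) (Complex (Re w + ln s) (Im w))) \<le> C * exp ((Re a - 1) * (Re w + ln s))" .
  define K where "K = norm (a - 1) * C * exp ((Re a - 1) * Re w) + norm (exp ((a - 1) * w))"
  have "\<forall>\<^sub>F s in at_top. norm (?H a s) \<le> K * s powr (Re a - 1)"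
    using C' eventually_gt_at_top[of 0]
  proof eventually_elim
    fix s :: real assume *: "norm (scaled_inc_Gamma (a - 1) (Complex (Re w + ln s) (Im w))) \<le> C * exp ((Re a - 1) * (Re w + ln s))"
      and s: "s > 0"
    have w: "Complex (Re w + ln s) (Im w) = w + of_real (ln s)" by (simp add: complex_eq_iff)
    have e: "exp ((Re a - 1) * (Re w + ln s)) = exp ((Re a - 1) * Re w) * s powr (Re a - 1)"
      using s by (simp add: powr_def algebra_simps flip: exp_add)
    have "norm (?H a s) = norm ((a - 1) * ?H (a - 1) s + exp ((a - 1) * (w + of_real (ln s))))"
      using scaled_inc_Gamma_plus1[of "a - 1"] by simp
    also have "\<dots> \<le> norm (a - 1) * norm (?H (a - 1) s) + norm (exp ((a - 1) * (w + of_real (ln s))))"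
      by (metis norm_mult norm_triangle_ineq)
    also have "norm (exp ((a - 1) * (w + of_real (ln s)))) = norm (exp ((a - 1) * w)) * s powr (Re a - 1)"
      using s by (simp add: powr_def algebra_simps flip: exp_add)
    also have "norm (a - 1) * norm (?H (a - 1) s) \<le> norm (a - 1) * (C * (exp ((Re a - 1) * Re w) * s powr (Re a - 1)))"
      using * unfolding w e by (intro mult_left_mono) auto
    finally show "norm (?H a s) \<le> K * s powr (Re a - 1)"
      by (simp add: K_def algebra_simps)
  qed
  then obtain S where S: "norm (?H a s) \<le> K * s powr (Re a - 1)" if "s \<ge> S" for s
    by (auto simp: eventually_at_top_linorder)
  have cont: "continuous_on {1..max 1 S} (\<lambda>s. norm (?H a s) / s powr (Re a - 1))"
  proof -
    have "continuous_on UNIV (scaled_inc_Gamma a)"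
      by (intro continuous_at_imp_continuous_on ballI DERIV_isCont[OF has_field_derivative_scaled_inc_Gamma])
    then have "continuous_on {1..max 1 S} (\<lambda>s. ?H a s)"
      by (rule continuous_on_compose2) (auto intro!: continuous_intros)
    then show ?thesis by (intro continuous_intros) auto
  qed
  then obtain B where B: "\<forall>y\<in>(\<lambda>s. norm (?H a s) / s powr (Re a - 1)) ` {1..max 1 S}. norm y \<le> B"
    using compact_imp_bounded[OF compact_continuous_image[OF cont compact_Icc]]
    unfolding bounded_iff by blast
  \<comment> \<open>\<open>K\<close> serves beyond \<open>S\<close>, \<open>B\<close> on the compact interval before it.\<close>
  have "norm (?H a s) \<le> max K B * s powr (Re a - 1)" if s: "s \<ge> 1" for s
  proof (cases "s \<ge> S")
    case True
    have "K * s powr (Re a - 1) \<le> max K B * s powr (Re a - 1)" by (intro mult_right_mono) auto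
    with S[OF True] show ?thesis by simp
  next
    case False
    then have "norm (?H a s) \<le> B * s powr (Re a - 1)"
      using B[rule_format, OF imageI, of s] s by (simp add: field_simps)
    also have "B * s powr (Re a - 1) \<le> max K B * s powr (Re a - 1)" by (intro mult_right_mono) auto
    finally show ?thesis .
  qed
  then show ?thesis by blast
qed

section \<open>The auxiliary functions along a ray\<close>

text \<open>
  For \<open>\<epsilon> = \<plusminus>1\<close> this is \<open>g + \<epsilon> \<i> f\<close>. These two combinations diagonalise both the differential system
  and the recurrence satisfied by \<open>f\<close> and \<open>g\<close>, and \<open>f\<^sup>2 + g\<^sup>2\<close> is their product. The parameter \<open>\<epsilon>\<close>
  allows both to be treated at once.
\<close>

definition aux_h :: "complex \<Rightarrow> complex \<Rightarrow> complex \<Rightarrow> complex" where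
  "aux_h \<epsilon> a z = exp (\<epsilon> * (of_real pi / 2 * \<i> * a)) * scaled_inc_Gamma a (Ln z - \<epsilon> * (of_real pi / 2 * \<i>))"

lemma exp_quarter_turn:
  assumes "\<epsilon> = 1 \<or> \<epsilon> = - 1"
  shows "exp (\<epsilon> * (of_real pi / 2 * \<i>)) = \<epsilon> * \<i>" "exp (- (\<epsilon> * (of_real pi / 2 * \<i>))) = - \<epsilon> * \<i>"
  using assms by (auto simp: exp_eq_polar complex_eq_iff Re_exp Im_exp)

lemma
  assumes "z \<noteq> 0"
  shows aux_f_eq_aux_h: "aux_f a z = (aux_h 1 a z - aux_h (- 1) a z) / (2 * \<i>)"
    and aux_g_eq_aux_h: "aux_g a z = (aux_h 1 a z + aux_h (- 1) a z) / 2"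
    and modulus_sq_eq_aux_h: "modulus_sq a z = aux_h 1 a z * aux_h (- 1) a z"
proof -
  have "exp (Ln z - of_real pi / 2 * \<i>) = - \<i> * z" "exp (Ln z + of_real pi / 2 * \<i>) = \<i> * z"
    using assms exp_quarter_turn[of 1] by (simp_all add: exp_diff exp_add exp_minus)
  then have h: "aux_h 1 a z = exp (of_real pi / 2 * \<i> * a) * exp (- \<i> * z) * inc_Gamma_log a (Ln z - of_real pi / 2 * \<i>)"
    "aux_h (- 1) a z = exp (- (of_real pi / 2 * \<i> * a)) * exp (\<i> * z) * inc_Gamma_log a (Ln z + of_real pi / 2 * \<i>)"
    by (simp_all add: aux_h_def scaled_inc_Gamma_def)
  show f: "aux_f a z = (aux_h 1 a z - aux_h (- 1) a z) / (2 * \<i>)"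
    and g: "aux_g a z = (aux_h 1 a z + aux_h (- 1) a z) / 2"
    unfolding h aux_f_def aux_g_def by (simp_all add: field_simps)
  show "modulus_sq a z = aux_h 1 a z * aux_h (- 1) a z"
    unfolding modulus_sq_def f g by (simp add: power2_eq_square field_simps)
qed

lemma aux_h_plus1:
  assumes "\<epsilon> = 1 \<or> \<epsilon> = - 1" "z \<noteq> 0"
  shows "aux_h \<epsilon> (a + 1) z = \<epsilon> * \<i> * (a * aux_h \<epsilon> a z + z powr a)"
proof -
  have "exp (\<epsilon> * (of_real pi / 2 * \<i> * a)) * exp (a * (Ln z - \<epsilon> * (of_real pi / 2 * \<i>))) = z powr a"
    using assms(2) by (simp add: powr_def algebra_simps flip: exp_add)
  moreover have "exp (\<epsilon> * (of_real pi / 2 * \<i> * (a + 1))) = \<epsilon> * \<i> * exp (\<epsilon> * (of_real pi / 2 * \<i> * a))"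
    unfolding exp_quarter_turn(1)[OF assms(1), symmetric]
    by (simp add: ring_distribs add_divide_distrib mult_ac add.commute flip: exp_add)
  ultimately show ?thesis
    unfolding aux_h_def scaled_inc_Gamma_plus1 by (simp add: algebra_simps)
qed

lemma Ln_ray:
  fixes z :: complex
  assumes "z \<noteq> 0" "s > 0"
  shows "Ln (z * of_real s) = Ln z + of_real (ln s)"
  using Ln_times_of_real[OF assms(2,1)] assms(2) by (simp add: mult.commute add.commute Ln_of_real)

lemma powr_ray:
  fixes z a :: complex
  assumes "z \<noteq> 0" "s > 0"
  shows "(z * of_real s) powr a = z powr a * of_real s powr a"
  using assms by (simp add: powr_def Ln_ray Ln_of_real exp_add ring_distribs)

lemma aux_h_ray_has_vector_derivative:
  assumes "\<epsilon> = 1 \<or> \<epsilon> = - 1" "z \<noteq> 0" "s > 0"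
  shows "((\<lambda>s. aux_h \<epsilon> a (z * of_real s)) has_vector_derivative
    - \<epsilon> * \<i> * z * aux_h \<epsilon> a (z * of_real s) - (z * of_real s) powr a / of_real s) (at s)"
proof -
  let ?w = "Ln z - \<epsilon> * (of_real pi / 2 * \<i>)"
  let ?E = "exp (\<epsilon> * (of_real pi / 2 * \<i> * a))"
  have "((\<lambda>s. complex_of_real (ln s)) has_vector_derivative of_real (1 / s)) (at s)"
    using assms(3) by (auto intro!: derivative_eq_intros has_vector_derivative_of_real
            simp: has_real_derivative_iff_has_vector_derivative[symmetric] divide_inverse)
  from has_vector_derivative_add[OF has_vector_derivative_const this]
  have "((\<lambda>s. ?w + of_real (ln s)) has_vector_derivative of_real (1 / s)) (at s)" by simp
  from field_vector_diff_chain_at[OF this has_field_derivative_scaled_inc_Gamma]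
  have "((\<lambda>s. ?E * scaled_inc_Gamma a (?w + of_real (ln s))) has_vector_derivative
     ?E * (of_real (1 / s) * (exp (?w + of_real (ln s)) * scaled_inc_Gamma a (?w + of_real (ln s))
        - exp (a * (?w + of_real (ln s)))))) (at s)"
    by (intro has_vector_derivative_mult_right) (simp add: o_def)
  moreover have "exp (?w + of_real (ln s)) = - \<epsilon> * \<i> * z * of_real s"
  proof -
    have "exp (complex_of_real (ln s)) = of_real s"
      using assms(3) by (metis exp_ln exp_of_real)
    moreover have "exp ?w = z * (- \<epsilon> * \<i>)"
      using assms(2) exp_quarter_turn(2)[OF assms(1)] unfolding diff_conv_add_uminus exp_add by simp
    ultimately show ?thesis unfolding exp_add by simp
  qed
  moreover have "?E * exp (a * (?w + of_real (ln s))) = (z * of_real s) powr a"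
    using assms by (simp add: powr_def Ln_ray algebra_simps flip: exp_add)
  moreover have "aux_h \<epsilon> a (z * of_real t) = ?E * scaled_inc_Gamma a (?w + of_real (ln t))" if "t > 0" for t
    using assms(2) that by (simp add: aux_h_def Ln_ray algebra_simps)
  moreover have "E * (of_real (1 / s) * (- \<epsilon> * \<i> * z * of_real s * H - X)) = - \<epsilon> * \<i> * z * (E * H) - E * X / of_real s"
    for E H X :: complex
    using assms(3) by (simp add: field_simps)
  ultimately have "((\<lambda>s. ?E * scaled_inc_Gamma a (?w + of_real (ln s))) has_vector_derivative
      - \<epsilon> * \<i> * z * aux_h \<epsilon> a (z * of_real s) - (z * of_real s) powr a / of_real s) (at s)"
    using assms(3) by (simp only:)
  then show ?thesis
  proof (rule has_vector_derivative_transform_within_open)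
    show "open {0::real<..}" "s \<in> {0<..}" using assms(3) by auto
    fix t :: real assume "t \<in> {0<..}"
    then show "?E * scaled_inc_Gamma a (?w + of_real (ln t)) = aux_h \<epsilon> a (z * of_real t)"
      using assms(2) by (simp add: aux_h_def Ln_ray algebra_simps)
  qed
qed

text \<open>
  This is where \<open>\<bar>Arg z\<bar> < pi\<close> enters: a quarter turn in either direction keeps the argument inside
  the sector of half-angle \<open>3 pi / 2\<close>.
\<close>

lemma aux_h_decay:
  assumes "\<epsilon> = 1 \<or> \<epsilon> = - 1" "z \<noteq> 0" "\<bar>Arg z\<bar> < pi"
  shows "\<exists>C. \<forall>s\<ge>1. norm (aux_h \<epsilon> a (z * of_real s)) \<le> C * s powr (Re a - 1)"
proof -
  let ?w = "Ln z - \<epsilon> * (of_real pi / 2 * \<i>)"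
  let ?E = "exp (\<epsilon> * (of_real pi / 2 * \<i> * a))"
  have "\<bar>Im ?w\<bar> < 3 * pi / 2"
  proof -
    have "Im ?w = Arg z - pi / 2 \<or> Im ?w = Arg z + pi / 2"
      using assms(1) Arg_eq_Im_Ln[OF assms(2)] by auto
    then show ?thesis using assms(3) unfolding abs_less_iff by (elim disjE) linarith+
  qed
  from scaled_inc_Gamma_decay[OF this, of a] obtain C
    where C: "\<And>s. s \<ge> 1 \<Longrightarrow> norm (scaled_inc_Gamma a (?w + of_real (ln s))) \<le> C * s powr (Re a - 1)"
    by blast
  have "norm (aux_h \<epsilon> a (z * of_real s)) \<le> norm ?E * C * s powr (Re a - 1)" if "s \<ge> 1" for s
  proof -
    have "Ln (z * of_real s) - \<epsilon> * (of_real pi / 2 * \<i>) = ?w + of_real (ln s)"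
      using assms that by (simp add: Ln_ray)
    then have "norm (aux_h \<epsilon> a (z * of_real s)) = norm ?E * norm (scaled_inc_Gamma a (?w + of_real (ln s)))"
      by (simp only: aux_h_def norm_mult)
    also have "\<dots> \<le> norm ?E * (C * s powr (Re a - 1))"
      by (rule mult_left_mono[OF C[OF that] norm_ge_zero])
    finally show ?thesis by (simp only: mult.assoc)
  qed
  then show ?thesis by blast
qed

lemma
  assumes "z \<noteq> 0"
  shows aux_f_plus1: "aux_f (a + 1) z = a * aux_g a z + z powr a"
    and aux_g_plus1: "aux_g (a + 1) z = - a * aux_f a z"
    and modulus_sq_plus1: "modulus_sq (a + 1) z = a\<^sup>2 * modulus_sq a z + 2 * a * z powr a * aux_g a z + z powr (2 * a)"
proof -
  define A B P where "A = aux_h 1 a z" and "B = aux_h (- 1) a z" and "P = z powr a"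
  have h: "aux_h 1 (a + 1) z = \<i> * (a * A + P)" "aux_h (- 1) (a + 1) z = - \<i> * (a * B + P)"
    using aux_h_plus1[OF _ assms, of 1 a] aux_h_plus1[OF _ assms, of "- 1" a]
    by (simp_all add: A_def B_def P_def)
  have P2: "z powr (2 * a) = P * P"
    unfolding P_def mult_2 by (rule powr_add)
  have i: "\<i> * (\<i> * w) = - w" for w :: complex
    by (simp flip: mult.assoc)
  show "aux_f (a + 1) z = a * aux_g a z + z powr a"
    unfolding aux_f_eq_aux_h[OF assms] aux_g_eq_aux_h[OF assms] h A_def[symmetric] B_def[symmetric] P_def[symmetric]
    by (simp add: field_simps)
  show "aux_g (a + 1) z = - a * aux_f a z"
    unfolding aux_f_eq_aux_h[OF assms] aux_g_eq_aux_h[OF assms] h A_def[symmetric] B_def[symmetric] P_def[symmetric]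
    by (simp add: field_simps i)
  show "modulus_sq (a + 1) z = a\<^sup>2 * modulus_sq a z + 2 * a * z powr a * aux_g a z + z powr (2 * a)"
    unfolding modulus_sq_eq_aux_h[OF assms] aux_g_eq_aux_h[OF assms] h P2 A_def[symmetric] B_def[symmetric] P_def[symmetric]
    by (simp add: power2_eq_square algebra_simps i)
qed

text \<open>
  In the derivative of the product of the two combinations the oscillating terms \<open>\<plusminus> \<i> z\<close> cancel.
  What is left is a multiple of \<open>g\<close>, which is the reason why the remainder for the squared modulus is an
  integral of the remainder for \<open>g\<close>.
\<close>

lemma
  assumes "z \<noteq> 0" "s > 0"
  shows aux_f_ray_has_vector_derivative: "((\<lambda>s. aux_f a (z * of_real s)) has_vector_derivative
      - z * aux_g a (z * of_real s)) (at s)"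
    and aux_g_ray_has_vector_derivative: "((\<lambda>s. aux_g a (z * of_real s)) has_vector_derivative
      z * aux_f a (z * of_real s) - (z * of_real s) powr a / of_real s) (at s)"
    and modulus_sq_ray_has_vector_derivative: "((\<lambda>s. modulus_sq a (z * of_real s)) has_vector_derivative
      - 2 * (z * of_real s) powr a / of_real s * aux_g a (z * of_real s)) (at s)"
proof -
  let ?h = "\<lambda>\<epsilon> s. aux_h \<epsilon> a (z * of_real s)"
  have d1: "(?h 1 has_vector_derivative - \<i> * z * ?h 1 s - (z * of_real s) powr a / of_real s) (at s)"
    and d2: "(?h (- 1) has_vector_derivative \<i> * z * ?h (- 1) s - (z * of_real s) powr a / of_real s) (at s)"
    using aux_h_ray_has_vector_derivative[OF _ assms, of 1 a]
      aux_h_ray_has_vector_derivative[OF _ assms, of "- 1" a] by simp_all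
  have ev: "open {0::real<..}" "s \<in> {0<..}" using assms by auto
  have zs: "z * of_real t \<noteq> 0" if "t \<in> {0<..}" for t :: real using that assms(1) by auto
  have "((\<lambda>s. (?h 1 s - ?h (- 1) s) / (2 * \<i>)) has_vector_derivative - z * aux_g a (z * of_real s)) (at s)"
    by (rule has_vector_derivative_eq_rhs[OF has_vector_derivative_divide[OF has_vector_derivative_diff[OF d1 d2]]])
      (simp add: aux_g_eq_aux_h[OF zs[OF ev(2)]] field_simps)
  then show "((\<lambda>s. aux_f a (z * of_real s)) has_vector_derivative - z * aux_g a (z * of_real s)) (at s)"
    by (rule has_vector_derivative_transform_within_open[OF _ ev]) (simp add: aux_f_eq_aux_h[OF zs])
  have "((\<lambda>s. (?h 1 s + ?h (- 1) s) / 2) has_vector_derivative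
      z * aux_f a (z * of_real s) - (z * of_real s) powr a / of_real s) (at s)"
    by (rule has_vector_derivative_eq_rhs[OF has_vector_derivative_divide[OF has_vector_derivative_add[OF d1 d2]]])
      (simp add: aux_f_eq_aux_h[OF zs[OF ev(2)]] field_simps flip: mult.assoc)
  then show "((\<lambda>s. aux_g a (z * of_real s)) has_vector_derivative
      z * aux_f a (z * of_real s) - (z * of_real s) powr a / of_real s) (at s)"
    by (rule has_vector_derivative_transform_within_open[OF _ ev]) (simp add: aux_g_eq_aux_h[OF zs])
  have "((\<lambda>s. ?h 1 s * ?h (- 1) s) has_vector_derivative
      - 2 * (z * of_real s) powr a / of_real s * aux_g a (z * of_real s)) (at s)"
    by (rule has_vector_derivative_eq_rhs[OF has_vector_derivative_mult[OF d1 d2]])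
      (simp add: aux_g_eq_aux_h[OF zs[OF ev(2)]] algebra_simps add_divide_distrib)
  then show "((\<lambda>s. modulus_sq a (z * of_real s)) has_vector_derivative
      - 2 * (z * of_real s) powr a / of_real s * aux_g a (z * of_real s)) (at s)"
    by (rule has_vector_derivative_transform_within_open[OF _ ev]) (simp add: modulus_sq_eq_aux_h[OF zs])
qed

text \<open>
  Two steps of the recurrence in the parameter return from \<open>f\<close> to \<open>f\<close>. Applied repeatedly this
  produces the asymptotic expansion of \<open>g\<close>; applied once it gives the upper bound \<open>1\<close> for the
  terminant on the positive real axis.
\<close>

lemma terminant_rec:
  assumes "z \<noteq> 0"
  shows "terminant p z = 1 - p * (p + 1) / z\<^sup>2 * terminant (p + 2) z"
proof -
  have "aux_f (1 - p) z = z powr (- p) - p * aux_g (- p) z"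
    using aux_f_plus1[OF assms, of "- p"] by simp
  moreover have "aux_g (- p) z = (1 + p) * aux_f (- 1 - p) z"
    using aux_g_plus1[OF assms, of "- 1 - p"] by simp
  ultimately have f: "aux_f (1 - p) z = z powr (- p) - p * (p + 1) * aux_f (1 - (p + 2)) z"
    by (simp add: algebra_simps)
  have e: "z powr p * z powr (- p) = 1" "z powr (p + 2) = z powr p * z\<^sup>2"
    using assms by (simp_all add: powr_minus powr_add)
  show ?thesis
    unfolding terminant_def f e(2) using assms e(1) by (simp add: right_diff_distrib)
qed

text \<open>
  The remainder of \<open>g\<close> is exactly the first omitted term times a terminant, so no estimate is lost
  before the final integration.
\<close>

lemma remainder_g_eq_terminant:
  assumes "z \<noteq> 0"
  shows "remainder_g N a z =
    (-1) ^ N * (pochhammer (1 - a) (2 * N + 1) / z ^ (2 * N + 1)) * terminant (of_nat (2 * N + 2) - a) z"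
proof (induction N)
  case 0
  have "z powr (2 - a) * z powr (a - 1) = z"
    using assms by (simp flip: powr_add)
  then have e: "z powr (2 - a) = z / z powr (a - 1)"
    using assms by (simp add: eq_divide_eq)
  have "aux_g a z = (1 - a) * aux_f (a - 1) z"
    using aux_g_plus1[OF assms, of "a - 1"] by simp
  then show ?case
    using assms e by (simp add: remainder_g_def terminant_def)
next
  case (Suc N)
  define p where "p = of_nat (2 * N + 2) - a"
  have p2: "of_nat (2 * Suc N + 2) - a = p + 2"
    by (simp add: p_def)
  have poch: "pochhammer (1 - a) (2 * Suc N + 1) = pochhammer (1 - a) (2 * N + 1) * (p * (p + 1))"
    by (simp add: p_def pochhammer_rec' algebra_simps)
  have "remainder_g (Suc N) a z = remainder_g N a z - (-1) ^ N * (pochhammer (1 - a) (2 * N + 1) / z ^ (2 * N + 1))"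
    by (simp add: remainder_g_def)
  also have "\<dots> = (-1) ^ N * (pochhammer (1 - a) (2 * N + 1) / z ^ (2 * N + 1)) * (terminant p z - 1)"
    unfolding Suc.IH p_def[symmetric] by (simp only: right_diff_distrib mult_1_right)
  also have "terminant p z - 1 = - (p * (p + 1) / z\<^sup>2 * terminant (p + 2) z)"
    by (subst terminant_rec[OF assms]) simp
  finally show ?case
    unfolding p2 poch by (simp add: power2_eq_square mult_ac)
qed

lemma terminant_bounded_on_ray:
  assumes "z \<noteq> 0" "\<bar>Arg z\<bar> < pi"
  shows "\<exists>C. \<forall>s\<ge>1. norm (terminant p (z * of_real s)) \<le> C"
proof -
  obtain C1 where C1: "norm (aux_h 1 (1 - p) (z * of_real s)) \<le> C1 * s powr (- Re p)" if "s \<ge> 1" for s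
    using aux_h_decay[OF _ assms, of 1 "1 - p"] by auto
  obtain C2 where C2: "norm (aux_h (- 1) (1 - p) (z * of_real s)) \<le> C2 * s powr (- Re p)" if "s \<ge> 1" for s
    using aux_h_decay[OF _ assms, of "- 1" "1 - p"] by auto
  have "norm (terminant p (z * of_real s)) \<le> norm (z powr p) * ((C1 + C2) / 2)" if s: "s \<ge> 1" for s
  proof -
    have "norm (aux_f (1 - p) (z * of_real s)) =
        norm (aux_h 1 (1 - p) (z * of_real s) - aux_h (- 1) (1 - p) (z * of_real s)) / 2"
      using s assms(1) by (simp add: aux_f_eq_aux_h norm_divide norm_mult)
    also have "\<dots> \<le> (C1 + C2) / 2 * s powr (- Re p)"
      using C1[OF s] C2[OF s] norm_triangle_ineq4[of "aux_h 1 (1 - p) (z * of_real s)" "aux_h (- 1) (1 - p) (z * of_real s)"]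
      by (simp add: field_simps)
    finally have "norm (of_real s powr p) * norm (aux_f (1 - p) (z * of_real s)) \<le>
        s powr Re p * ((C1 + C2) / 2 * s powr (- Re p))"
      using s by (intro mult_mono) (auto simp: norm_powr_real_powr)
    also have "\<dots> = (C1 + C2) / 2"
      using s by (simp add: powr_minus)
    finally have "norm (z powr p) * (norm (of_real s powr p) * norm (aux_f (1 - p) (z * of_real s))) \<le>
        norm (z powr p) * ((C1 + C2) / 2)"
      by (intro mult_left_mono) auto
    then show ?thesis
      using s assms(1) by (simp add: terminant_def powr_ray norm_mult mult.assoc)
  qed
  then show ?thesis by blast
qed

lemma terminant_continuous_on_ray:
  assumes "z \<noteq> 0"
  shows "continuous_on {0<..} (\<lambda>s. terminant p (z * of_real s))"
proof -
  have "continuous_on {0<..} (\<lambda>s. aux_f (1 - p) (z * of_real s))"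
    by (intro continuous_at_imp_continuous_on ballI
        has_vector_derivative_continuous[OF aux_f_ray_has_vector_derivative[OF assms]]) auto
  then have "continuous_on {0<..} (\<lambda>s. z powr p * of_real s powr p * aux_f (1 - p) (z * of_real s))"
    by (intro continuous_intros) auto
  then show ?thesis
    by (rule continuous_on_eq) (use assms in \<open>simp add: terminant_def powr_ray\<close>)
qed

section \<open>Integrals over a half-line\<close>

lemma absolutely_integrable_powr_bound:
  fixes f :: "real \<Rightarrow> 'a :: euclidean_space"
  assumes "continuous_on {1..} f" "e < -1" "\<And>s. s \<ge> 1 \<Longrightarrow> norm (f s) \<le> C * s powr e"
  shows "f absolutely_integrable_on {1..}"
proof (rule measurable_bounded_by_integrable_imp_absolutely_integrable)
  show "f \<in> borel_measurable (lebesgue_on {1..})"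
    by (rule continuous_imp_measurable_on_sets_lebesgue[OF assms(1)]) auto
  show "(\<lambda>s. C * s powr e) integrable_on {1..}"
    using has_integral_mult_right[OF has_integral_powr_to_inf[OF assms(2), of 1]] by (auto simp: integrable_on_def)
qed (use assms(3) in auto)

lemma has_integral_derivative_at_top:
  fixes f F :: "real \<Rightarrow> 'a :: euclidean_space"
  assumes f: "f absolutely_integrable_on {a..}"
    and F: "\<And>s. s \<ge> a \<Longrightarrow> (F has_vector_derivative f s) (at s)" "(F \<longlongrightarrow> l) at_top"
  shows "(f has_integral l - F a) {a..}"
proof -
  have sub: "f absolutely_integrable_on {a..x}" for x
    by (rule set_integrable_subset[OF f]) auto
  have "((\<lambda>x. set_lebesgue_integral lebesgue {a..x} f) \<longlongrightarrow> set_lebesgue_integral lebesgue {a..} f) at_top"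
    by (rule tendsto_set_lebesgue_integral_at_top[OF _ f]) auto
  then have lim: "((\<lambda>x. integral {a..x} f) \<longlongrightarrow> integral {a..} f) at_top"
    using set_lebesgue_integral_eq_integral(2)[OF f] set_lebesgue_integral_eq_integral(2)[OF sub] by simp
  have "integral {a..x} f = F x - F a" if "x \<ge> a" for x
    using that F(1)
    by (intro integral_unique fundamental_theorem_of_calculus) (auto intro: has_vector_derivative_at_within)
  then have "\<forall>\<^sub>F x in at_top. integral {a..x} f = F x - F a"
    using eventually_mono[OF eventually_ge_at_top[of a]] by auto
  from Lim_transform_eventually[OF lim this] have "((\<lambda>x. F x - F a) \<longlongrightarrow> integral {a..} f) at_top" .
  moreover have "((\<lambda>x. F x - F a) \<longlongrightarrow> l - F a) at_top"
    by (intro tendsto_intros F(2))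
  ultimately have "integral {a..} f = l - F a"
    by (intro tendsto_unique) auto
  then show ?thesis
    using set_lebesgue_integral_eq_integral(1)[OF f] by (metis integrable_integral)
qed

lemma weighted_powr_integral_bounds:
  fixes \<phi> :: "real \<Rightarrow> real"
  assumes cont: "continuous_on {1..} \<phi>" and \<phi>: "\<And>s. s \<ge> 1 \<Longrightarrow> 0 < \<phi> s" "\<And>s. s \<ge> 1 \<Longrightarrow> \<phi> s \<le> 1"
    and e: "e < -1"
  shows "\<exists>I>0. I \<le> 1 / (- e - 1) \<and> ((\<lambda>s. s powr e * \<phi> s) has_integral I) {1..}"
proof -
  let ?f = "\<lambda>s. s powr e * \<phi> s"
  have cont_f: "continuous_on {1..} ?f"
    by (intro continuous_intros cont) auto
  have "?f absolutely_integrable_on {1..}"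
  proof (rule absolutely_integrable_powr_bound[OF cont_f e])
    fix s :: real assume s: "s \<ge> 1"
    show "norm (?f s) \<le> 1 * s powr e"
      using \<phi>[OF s] by (simp add: abs_mult mult_left_le)
  qed
  then have int: "?f integrable_on {1..}"
    by (rule set_lebesgue_integral_eq_integral(1))
  have g: "((\<lambda>s. s powr e) has_integral 1 / (- e - 1)) {1..}"
    using has_integral_powr_to_inf[OF e, of 1] by (simp add: minus_divide_right)
  have "integral {1..} ?f \<le> 1 / (- e - 1)"
    using \<phi> by (intro has_integral_le[OF integrable_integral[OF int] g]) (auto simp: mult_left_le)
  moreover have "0 < integral {1..} ?f"
  proof -
    \<comment> \<open>A positive minimum on \<open>[1, 2]\<close> already makes the integral positive.\<close>
    have sub: "continuous_on {1..2} ?f"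
      by (rule continuous_on_subset[OF cont_f]) auto
    then obtain m where m: "m \<in> {1..2}" "\<And>s. s \<in> {1..2} \<Longrightarrow> ?f m \<le> ?f s"
      using continuous_attains_inf[of "{1..2}" ?f] by auto
    have "0 < ?f m" using m(1) \<phi>(1)[of m] by simp
    also have "?f m = integral {1..2::real} (\<lambda>s. ?f m)" by simp
    also have "\<dots> \<le> integral {1..2} ?f"
      using m(2) by (intro integral_le integrable_continuous_interval sub continuous_on_const) auto
    also have "\<dots> \<le> integral {1..} ?f"
      using \<phi>(1) by (intro integral_subset_le integrable_continuous_interval sub int) (auto intro: less_imp_le)
    finally show ?thesis .
  qed
  ultimately show ?thesis
    using integrable_integral[OF int] by blast
qed

section \<open>The expansion of the squared modulus\<close>

lemma M_coeff_times: "(of_nat n + 1 - a) * M_coeff n a = pochhammer (1 - a) (2 * n + 1)"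
proof -
  have "pochhammer (1 - a) (2 * n + 1) = (\<Prod>k\<in>{..2 * n}. of_nat k + 1 - a)"
    by (simp add: pochhammer_prod atLeast0LessThan lessThan_Suc_atMost algebra_simps del: prod.lessThan_Suc)
  also have "\<dots> = (of_nat n + 1 - a) * M_coeff n a"
    unfolding M_coeff_eq_prod by (rule prod.remove) auto
  finally show ?thesis by simp
qed

lemma M_coeff_0 [simp]: "M_coeff 0 a = 1"
  by (simp add: M_coeff_eq_prod)

text \<open>
  The coefficient form of \<open>M\<^sup>2(a+1,z) = a\<^sup>2 M\<^sup>2(a,z) + 2 a z\<^bsup>a\<^esup> g(a,z) + z\<^bsup>2a\<^esup>\<close>.
\<close>

lemma M_coeff_Suc:
  "M_coeff (Suc n) (a + 1) = - (a\<^sup>2 * M_coeff n a + 2 * a * pochhammer (1 - a) (2 * n + 1))"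
proof -
  have set_eq: "{..2 * Suc n} - {Suc n} = insert 0 (insert (2 * n + 2) (Suc ` ({..2 * n} - {n})))"
  proof (intro equalityI subsetI)
    fix k assume "k \<in> {..2 * Suc n} - {Suc n}"
    then show "k \<in> insert 0 (insert (2 * n + 2) (Suc ` ({..2 * n} - {n})))"
      by (cases k) (auto simp: image_iff)
  qed auto
  have "M_coeff (Suc n) (a + 1) = (\<Prod>k\<in>{..2 * Suc n} - {Suc n}. of_nat k - a)"
    by (simp add: M_coeff_eq_prod)
  also have "\<dots> = - a * ((of_nat (2 * n + 2) - a) * (\<Prod>k\<in>Suc ` ({..2 * n} - {n}). of_nat k - a))"
    unfolding set_eq by (subst prod.insert; (subst prod.insert)?) auto
  also have "(\<Prod>k\<in>Suc ` ({..2 * n} - {n}). of_nat k - a) = M_coeff n a"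
    unfolding M_coeff_eq_prod by (subst prod.reindex) (auto simp: algebra_simps)
  finally show ?thesis
    unfolding M_coeff_times[symmetric] by (simp add: algebra_simps power2_eq_square)
qed

text \<open>
  The recurrence for the squared modulus passes to the remainders exactly. It makes the decay of
  the remainder accessible by induction on \<open>N\<close>, without multiplying two asymptotic expansions.
\<close>

lemma remainder_M_plus1:
  assumes "z \<noteq> 0"
  shows "z\<^sup>2 * remainder_M (Suc N) (a + 1) z = a\<^sup>2 * remainder_M N a z + 2 * a * remainder_g N a z"
proof (induction N)
  case 0
  define Q where "Q = z powr (a - 1)"
  have Q: "Q \<noteq> 0" using assms by (simp add: Q_def)
  have QQ: "Q * Q = z powr (2 * a - 2)"
    by (simp add: Q_def flip: powr_add)
  have e1: "z powr a = Q * z"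
    using assms powr_add[of z "a - 1" 1] by (simp add: Q_def)
  have e2: "z powr (2 * a) = Q * Q * z\<^sup>2"
    using assms powr_add[of z "2 * a - 2" 2] by (simp add: QQ)
  have e3: "z powr (2 * a - 1) = Q * Q * z"
    using assms powr_add[of z "2 * a - 2" 1] by (simp add: QQ)
  have e4: "z powr (2 * (a + 1) - 1) = Q * Q * z ^ 3"
    using assms powr_add[of z "2 * a - 2" 3] by (simp add: QQ algebra_simps)
  have "z\<^sup>2 * remainder_M 1 (a + 1) z =
      z\<^sup>2 * ((a\<^sup>2 * modulus_sq a z + 2 * a * (Q * z) * aux_g a z + Q * Q * z\<^sup>2) / (Q * Q * z ^ 3) - 1 / z)"
    by (simp only: remainder_M_def modulus_sq_plus1[OF assms] e1 e2 e4) simp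
  also have "\<dots> = a\<^sup>2 * (modulus_sq a z / (Q * Q * z)) + 2 * a * (aux_g a z / Q)"
    using Q assms by (simp add: field_simps power2_eq_square power3_eq_cube)
  finally show ?case
    by (simp add: remainder_M_def[of 0] remainder_g_def[of 0] e3 Q_def[symmetric])
next
  case (Suc N)
  have "z\<^sup>2 * remainder_M (Suc (Suc N)) (a + 1) z =
      z\<^sup>2 * remainder_M (Suc N) (a + 1) z - z\<^sup>2 * ((-1) ^ Suc N * M_coeff (Suc N) (a + 1) * (1 / z ^ (2 * Suc N + 1)))"
    by (simp add: remainder_M_def right_diff_distrib)
  also have "z\<^sup>2 * ((-1) ^ Suc N * M_coeff (Suc N) (a + 1) * (1 / z ^ (2 * Suc N + 1))) =
      a\<^sup>2 * ((-1) ^ N * M_coeff N a * (1 / z ^ (2 * N + 1))) +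
      2 * a * ((-1) ^ N * (pochhammer (1 - a) (2 * N + 1) / z ^ (2 * N + 1)))"
  proof -
    define P Z where "P = pochhammer (1 - a) (2 * N + 1)" and "Z = z ^ (2 * N + 1)"
    have "z ^ (2 * Suc N + 1) = z\<^sup>2 * Z"
      by (simp add: Z_def power2_eq_square)
    moreover have "Z \<noteq> 0"
      using assms by (simp add: Z_def)
    ultimately show ?thesis
      unfolding M_coeff_Suc P_def[symmetric] Z_def[symmetric] using assms by (simp add: field_simps)
  qed
  also have "z\<^sup>2 * remainder_M (Suc N) (a + 1) z = a\<^sup>2 * remainder_M N a z + 2 * a * remainder_g N a z"
    by (rule Suc.IH)
  finally show ?case
    by (simp add: remainder_M_def remainder_g_def algebra_simps)
qed

lemma remainder_g_bound_on_ray: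
  assumes "z \<noteq> 0" "s \<ge> 1" "norm (terminant (of_nat (2 * N + 2) - a) (z * of_real s)) \<le> S"
  shows "norm (of_real s powr (2 * a - 2) * remainder_g N a (z * of_real s)) \<le>
    norm (pochhammer (1 - a) (2 * N + 1)) / norm z ^ (2 * N + 1) * S * s powr (2 * Re a - real (2 * N + 3))"
proof -
  have "s powr (2 * Re a - real (2 * N + 3)) = s powr ((2 * Re a - 2) - real (2 * N + 1))"
    by (rule arg_cong) simp
  also have "\<dots> = s powr (2 * Re a - 2) / s ^ (2 * N + 1)"
    using assms(2) by (simp only: powr_diff powr_realpow)
  finally have e: "s powr (2 * Re a - real (2 * N + 3)) = s powr (2 * Re a - 2) / s ^ (2 * N + 1)" .
  have "norm (of_real s powr (2 * a - 2) * remainder_g N a (z * of_real s)) =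
      norm (pochhammer (1 - a) (2 * N + 1)) / norm z ^ (2 * N + 1) * (s powr (2 * Re a - 2) / s ^ (2 * N + 1))
        * norm (terminant (of_nat (2 * N + 2) - a) (z * of_real s))"
    using assms(1,2)
    by (simp add: remainder_g_eq_terminant norm_mult norm_divide norm_power norm_powr_real_powr power_mult_distrib del: power_Suc)
  also have "\<dots> \<le> norm (pochhammer (1 - a) (2 * N + 1)) / norm z ^ (2 * N + 1) * (s powr (2 * Re a - 2) / s ^ (2 * N + 1)) * S"
    using assms(2,3) by (intro mult_left_mono) auto
  finally show ?thesis unfolding e by (simp add: mult_ac)
qed

lemma remainder_g_absolutely_integrable:
  assumes "z \<noteq> 0" "\<bar>Arg z\<bar> < pi" "Re a < real N + 1"
  shows "(\<lambda>s. of_real s powr (2 * a - 2) * remainder_g N a (z * of_real s)) absolutely_integrable_on {1..}"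
proof -
  obtain C where C: "norm (terminant (of_nat (2 * N + 2) - a) (z * of_real s)) \<le> C" if "s \<ge> 1" for s
    using terminant_bounded_on_ray[OF assms(1,2)] by blast
  show ?thesis
  proof (rule absolutely_integrable_powr_bound)
    show "norm (of_real s powr (2 * a - 2) * remainder_g N a (z * of_real s)) \<le>
      norm (pochhammer (1 - a) (2 * N + 1)) / norm z ^ (2 * N + 1) * C * s powr (2 * Re a - real (2 * N + 3))"
      if "s \<ge> 1" for s using remainder_g_bound_on_ray[OF assms(1) that C[OF that]] .
    show "2 * Re a - real (2 * N + 3) < -1" using assms(3) by simp
    have "continuous_on {1..} (\<lambda>s. terminant (of_nat (2 * N + 2) - a) (z * of_real s))"
      by (rule continuous_on_subset[OF terminant_continuous_on_ray[OF assms(1)]]) auto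
    then have "continuous_on {1..} (\<lambda>s. of_real s powr (2 * a - 2) * ((-1) ^ N *
      (pochhammer (1 - a) (2 * N + 1) / (z * of_real s) ^ (2 * N + 1)) * terminant (of_nat (2 * N + 2) - a) (z * of_real s)))"
      using assms(1) by (intro continuous_intros) auto
    then show "continuous_on {1..} (\<lambda>s. of_real s powr (2 * a - 2) * remainder_g N a (z * of_real s))"
      by (rule continuous_on_eq) (use assms(1) in \<open>subst remainder_g_eq_terminant; simp\<close>)
  qed
qed

lemma remainder_g_weighted_tendsto_0:
  assumes "z \<noteq> 0" "\<bar>Arg z\<bar> < pi" "Re a < real N + 1"
  shows "((\<lambda>s. of_real s powr (2 * a - 1) * remainder_g N a (z * of_real s)) \<longlongrightarrow> 0) at_top"
proof -
  obtain C where C: "norm (terminant (of_nat (2 * N + 2) - a) (z * of_real s)) \<le> C" if "s \<ge> 1" for s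
    using terminant_bounded_on_ray[OF assms(1,2)] by blast
  define K where "K = norm (pochhammer (1 - a) (2 * N + 1)) / norm z ^ (2 * N + 1) * C"
  show ?thesis
  proof (rule Lim_null_comparison)
    show "\<forall>\<^sub>F s in at_top. norm (of_real s powr (2 * a - 1) * remainder_g N a (z * of_real s)) \<le> K * s powr (2 * Re a - real (2 * N + 2))"
      using eventually_ge_at_top[of 1]
    proof eventually_elim
      fix s :: real assume s: "s \<ge> 1"
      have "of_real s powr (2 * a - 1) = of_real s * of_real s powr (2 * a - 2)"
        using s powr_add[of "complex_of_real s" 1 "2 * a - 2"] by simp
      then have "norm (of_real s powr (2 * a - 1) * remainder_g N a (z * of_real s)) =
          s * norm (of_real s powr (2 * a - 2) * remainder_g N a (z * of_real s))"
        using s by (simp add: norm_mult)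
      also have "\<dots> \<le> s * (K * s powr (2 * Re a - real (2 * N + 3)))"
        unfolding K_def using s by (intro mult_left_mono remainder_g_bound_on_ray[OF assms(1) s C[OF s]]) auto
      also have "\<dots> = K * s powr (2 * Re a - real (2 * N + 2))"
        using s powr_add[of s 1 "2 * Re a - real (2 * N + 3)"] by (simp add: algebra_simps)
      finally show "norm (of_real s powr (2 * a - 1) * remainder_g N a (z * of_real s)) \<le> K * s powr (2 * Re a - real (2 * N + 2))" .
    qed
    have "((\<lambda>s. s powr (2 * Re a - real (2 * N + 2))) \<longlongrightarrow> 0) at_top"
      using assms(3) by (intro tendsto_neg_powr filterlim_ident) simp
    from tendsto_mult[OF tendsto_const this, of K]
    show "((\<lambda>s. K * s powr (2 * Re a - real (2 * N + 2))) \<longlongrightarrow> 0) at_top" by simp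
  qed
qed

lemma modulus_sq_tendsto_0:
  assumes "z \<noteq> 0" "\<bar>Arg z\<bar> < pi" "Re a < 1"
  shows "((\<lambda>s. modulus_sq a (z * of_real s)) \<longlongrightarrow> 0) at_top"
proof -
  have "((\<lambda>s. aux_h \<epsilon> a (z * of_real s)) \<longlongrightarrow> 0) at_top" if \<epsilon>: "\<epsilon> = 1 \<or> \<epsilon> = -1" for \<epsilon>
  proof -
    obtain C where C: "norm (aux_h \<epsilon> a (z * of_real s)) \<le> C * s powr (Re a - 1)" if "s \<ge> 1" for s
      using aux_h_decay[OF \<epsilon> assms(1,2)] by blast
    have "((\<lambda>s. s powr (Re a - 1)) \<longlongrightarrow> 0) at_top"
      using assms(3) by (intro tendsto_neg_powr filterlim_ident) simp
    from tendsto_mult[OF tendsto_const this, of C]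
    have "((\<lambda>s. C * s powr (Re a - 1)) \<longlongrightarrow> 0) at_top" by simp
    then show ?thesis
      by (rule Lim_null_comparison[rotated]) (rule eventually_mono[OF eventually_ge_at_top[of 1] C])
  qed
  then have "((\<lambda>s. aux_h 1 a (z * of_real s) * aux_h (- 1) a (z * of_real s)) \<longlongrightarrow> 0 * 0) at_top"
    by (intro tendsto_mult) auto
  moreover have "\<forall>\<^sub>F s in at_top. aux_h 1 a (z * of_real s) * aux_h (- 1) a (z * of_real s) = modulus_sq a (z * of_real s)"
    using eventually_gt_at_top[of 0] by eventually_elim (use assms(1) in \<open>simp add: modulus_sq_eq_aux_h\<close>)
  ultimately show ?thesis
    by (auto intro: Lim_transform_eventually)
qed

text \<open>
  The weighted remainder is, up to the factor \<open>- 2\<close>, a primitive of an integrable function, so it has a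
  limit. The point is that this limit is \<open>0\<close>: the expansion of the squared modulus hides no constant term. For \<open>N = 0\<close> one
  has \<open>Re a < 1\<close> and both factors of the squared modulus decay. The step from \<open>N\<close> to \<open>N + 1\<close>
  lowers \<open>a\<close> by one, which preserves the condition \<open>Re a < N + 1\<close>.
\<close>

lemma remainder_M_weighted_tendsto_0:
  assumes "z \<noteq> 0" "\<bar>Arg z\<bar> < pi" "Re a < real N + 1"
  shows "((\<lambda>s. of_real s powr (2 * a - 1) * remainder_M N a (z * of_real s)) \<longlongrightarrow> 0) at_top"
  using assms(3)
proof (induction N arbitrary: a)
  case 0
  then have "((\<lambda>s. modulus_sq a (z * of_real s) / z powr (2 * a - 1)) \<longlongrightarrow> 0 / z powr (2 * a - 1)) at_top"
    using assms by (intro tendsto_intros modulus_sq_tendsto_0) auto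
  moreover have "\<forall>\<^sub>F s in at_top. modulus_sq a (z * of_real s) / z powr (2 * a - 1) =
      of_real s powr (2 * a - 1) * remainder_M 0 a (z * of_real s)"
    using eventually_gt_at_top[of 0]
    by eventually_elim (use assms(1) in \<open>simp add: remainder_M_def powr_ray\<close>)
  ultimately show ?case by (auto intro: Lim_transform_eventually)
next
  case (Suc N)
  define b where "b = a - 1"
  \<comment> \<open>In terms of \<open>b\<close> the weight \<open>s powr (2 * a - 1)\<close> is \<open>s\<^sup>2 * s powr (2 * b - 1)\<close>; the square joins the factor \<open>z\<^sup>2\<close>.\<close>
  have ab: "a = b + 1" and b: "Re b < real N + 1"
    using Suc.prems by (simp_all add: b_def)
  have "((\<lambda>s. (b\<^sup>2 * (of_real s powr (2 * b - 1) * remainder_M N b (z * of_real s)) +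
      2 * b * (of_real s powr (2 * b - 1) * remainder_g N b (z * of_real s))) / z\<^sup>2) \<longlongrightarrow> (b\<^sup>2 * 0 + 2 * b * 0) / z\<^sup>2) at_top"
    by (intro tendsto_intros Suc.IH[OF b] remainder_g_weighted_tendsto_0[OF assms(1,2) b]) (use assms(1) in auto)
  moreover have "\<forall>\<^sub>F s in at_top. (b\<^sup>2 * (of_real s powr (2 * b - 1) * remainder_M N b (z * of_real s)) +
      2 * b * (of_real s powr (2 * b - 1) * remainder_g N b (z * of_real s))) / z\<^sup>2 =
      of_real s powr (2 * a - 1) * remainder_M (Suc N) a (z * of_real s)"
    using eventually_gt_at_top[of 0]
  proof eventually_elim
    fix s :: real assume s: "s > 0"
    have p: "of_real s powr (2 * a - 1) = of_real s powr (2 * b - 1) * (of_real s)\<^sup>2"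
      using s powr_add[of "complex_of_real s" "2 * b - 1" 2] by (simp add: ab algebra_simps)
    have "(z * of_real s)\<^sup>2 * remainder_M (Suc N) a (z * of_real s) =
        b\<^sup>2 * remainder_M N b (z * of_real s) + 2 * b * remainder_g N b (z * of_real s)"
      unfolding ab using s assms(1) by (intro remainder_M_plus1) auto
    then have "(b\<^sup>2 * (of_real s powr (2 * b - 1) * remainder_M N b (z * of_real s)) +
      2 * b * (of_real s powr (2 * b - 1) * remainder_g N b (z * of_real s))) / z\<^sup>2 =
      of_real s powr (2 * b - 1) * ((z * of_real s)\<^sup>2 * remainder_M (Suc N) a (z * of_real s)) / z\<^sup>2"
      by (simp add: algebra_simps)
    then show "(b\<^sup>2 * (of_real s powr (2 * b - 1) * remainder_M N b (z * of_real s)) +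
      2 * b * (of_real s powr (2 * b - 1) * remainder_g N b (z * of_real s))) / z\<^sup>2 =
      of_real s powr (2 * a - 1) * remainder_M (Suc N) a (z * of_real s)"
      using assms(1) by (simp add: p power_mult_distrib)
  qed
  ultimately show ?case by (auto intro: Lim_transform_eventually)
qed

text \<open>
  Starting from the derivative of the squared modulus, the terms of the two expansions are removed one by one.
  They match because \<open>(n + 1 - a)\<close> times the coefficient of the squared modulus is that of \<open>g\<close>, also
  at \<open>a = n + 1\<close>, where both sides vanish.
\<close>

lemma remainder_M_ray_has_vector_derivative:
  assumes "z \<noteq> 0" "s > 0"
  shows "((\<lambda>s. of_real s powr (2 * a - 1) * remainder_M N a (z * of_real s)) has_vector_derivative
    - 2 * (of_real s powr (2 * a - 2) * remainder_g N a (z * of_real s))) (at s)"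
proof (induction N)
  case 0
  have "((\<lambda>s. modulus_sq a (z * of_real s) / z powr (2 * a - 1)) has_vector_derivative
      - 2 * (z * of_real s) powr a / of_real s * aux_g a (z * of_real s) / z powr (2 * a - 1)) (at s)"
    by (intro has_vector_derivative_divide modulus_sq_ray_has_vector_derivative assms)
  moreover have "- 2 * (z * of_real s) powr a / of_real s * aux_g a (z * of_real s) / z powr (2 * a - 1) =
      - 2 * (of_real s powr (2 * a - 2) * remainder_g 0 a (z * of_real s))"
  proof -
    have s: "complex_of_real s \<noteq> 0" using assms(2) by simp
    have "z powr (2 * a - 1) = z powr a * z powr (a - 1)"
      "complex_of_real s powr a = of_real s powr (a - 1) * of_real s"
      "complex_of_real s powr (2 * a - 2) = of_real s powr (a - 1) * of_real s powr (a - 1)"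
      using s powr_add[of "complex_of_real s" "a - 1" 1] by (simp_all flip: powr_add)
    then show ?thesis
      using assms s by (simp add: remainder_g_def powr_ray)
  qed
  ultimately have "((\<lambda>s. modulus_sq a (z * of_real s) / z powr (2 * a - 1)) has_vector_derivative
      - 2 * (of_real s powr (2 * a - 2) * remainder_g 0 a (z * of_real s))) (at s)"
    by (simp only:)
  then show ?case
    by (rule has_vector_derivative_transform_within_open[where S = "{0<..}"])
      (use assms in \<open>auto simp: remainder_M_def powr_ray\<close>)
next
  case (Suc N)
  define K where "K = (-1) ^ N * M_coeff N a / z ^ (2 * N + 1)"
  define e where "e = 2 * a - 1 - of_nat (2 * N + 1)"
  have "((\<lambda>s. complex_of_real s powr e) has_vector_derivative e * of_real s powr (e - 1)) (at s)"
    using assms(2) by (intro has_vector_derivative_real_field has_field_derivative_powr) auto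
  from has_vector_derivative_diff[OF Suc.IH has_vector_derivative_mult_right[OF this, of K]]
  have "((\<lambda>s. of_real s powr (2 * a - 1) * remainder_M N a (z * of_real s) - K * of_real s powr e) has_vector_derivative
      - 2 * (of_real s powr (2 * a - 2) * remainder_g N a (z * of_real s)) - K * (e * of_real s powr (e - 1))) (at s)" .
  moreover have pow: "complex_of_real t powr (c - of_nat m) = of_real t powr c / of_real t ^ m" if "t > 0" for t c m
    using that by (simp add: powr_diff powr_nat')
  have "e * K = - 2 * ((-1) ^ N * pochhammer (1 - a) (2 * N + 1) / z ^ (2 * N + 1))"
    unfolding M_coeff_times[symmetric] K_def e_def by (simp add: algebra_simps)
  moreover have "of_real s powr (e - 1) = of_real s powr (2 * a - 2) / of_real s ^ (2 * N + 1)"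
    using pow[OF assms(2), of "2 * a - 2" "2 * N + 1"] by (simp add: e_def algebra_simps)
  moreover have "remainder_g (Suc N) a (z * of_real s) = remainder_g N a (z * of_real s)
      - (-1) ^ N * pochhammer (1 - a) (2 * N + 1) / z ^ (2 * N + 1) / of_real s ^ (2 * N + 1)"
    by (simp add: remainder_g_def power_mult_distrib)
  moreover have "- 2 * (X * R) - K * (e * (X / Y)) = - 2 * (X * (R - Z / Y))" if "e * K = - 2 * Z" for X Y Z R
  proof -
    have "K * (e * (X / Y)) = - 2 * Z * (X / Y)"
      unfolding that[symmetric] by (simp add: mult_ac)
    then show ?thesis by (simp add: algebra_simps)
  qed
  ultimately have "((\<lambda>s. of_real s powr (2 * a - 1) * remainder_M N a (z * of_real s) - K * of_real s powr e) has_vector_derivative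
      - 2 * (of_real s powr (2 * a - 2) * remainder_g (Suc N) a (z * of_real s))) (at s)"
    by (simp only:)
  then show ?case
  proof (rule has_vector_derivative_transform_within_open[where S = "{0<..}"])
    fix t :: real assume t: "t \<in> {0<..}"
    have "remainder_M (Suc N) a (z * of_real t) = remainder_M N a (z * of_real t) - K / of_real t ^ (2 * N + 1)"
      by (simp add: remainder_M_def K_def power_mult_distrib)
    moreover have "of_real t powr e = of_real t powr (2 * a - 1) / of_real t ^ (2 * N + 1)"
      using t unfolding e_def by (intro pow) auto
    ultimately show "of_real t powr (2 * a - 1) * remainder_M N a (z * of_real t) - K * of_real t powr e =
        of_real t powr (2 * a - 1) * remainder_M (Suc N) a (z * of_real t)"
      by (simp add: right_diff_distrib mult_ac)
  qed (use assms in auto)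
qed

lemma remainder_M_has_integral:
  assumes "z \<noteq> 0" "\<bar>Arg z\<bar> < pi" "Re a < real N + 1"
  shows "((\<lambda>s. of_real s powr (2 * a - 2) * remainder_g N a (z * of_real s)) has_integral remainder_M N a z / 2) {1..}"
proof -
  let ?f = "\<lambda>s. of_real s powr (2 * a - 2) * remainder_g N a (z * of_real s)"
  have "(\<lambda>s. - 2 * ?f s) absolutely_integrable_on {1..}"
    by (rule set_integrable_mult_right[OF remainder_g_absolutely_integrable[OF assms]])
  from has_integral_derivative_at_top[OF this remainder_M_ray_has_vector_derivative[OF assms(1)]
      remainder_M_weighted_tendsto_0[OF assms]]
  have "((\<lambda>s. - 2 * ?f s) has_integral - remainder_M N a z) {1..}" by simp
  from has_integral_mult_right[OF this, of "- 1 / 2"] show ?thesis by simp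
qed

text \<open>
  The factor \<open>1 / (N + 1 - Re a)\<close> is twice the integral of \<open>s powr (2 * Re a - 2 * N - 3)\<close> over \<open>[1, \<infinity>)\<close>.
\<close>

lemma remainder_M_norm_bound:
  assumes "z \<noteq> 0" "\<bar>Arg z\<bar> < pi" "Re a < real N + 1"
    and S: "\<And>s. s \<ge> 1 \<Longrightarrow> norm (terminant (of_nat (2 * N + 2) - a) (z * of_real s)) \<le> S"
  shows "norm (remainder_M N a z) \<le>
    norm (pochhammer (1 - a) (2 * N + 1)) / (real N + 1 - Re a) * (1 / norm z ^ (2 * N + 1)) * S"
proof -
  define K where "K = norm (pochhammer (1 - a) (2 * N + 1)) / norm z ^ (2 * N + 1) * S"
  define e d where "e = 2 * Re a - real (2 * N + 3)" and "d = real N + 1 - Re a"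
  have e: "e < -1" "e + 1 = - 2 * d" using assms(3) by (simp_all add: e_def d_def)
  have g: "((\<lambda>s. K * s powr e) has_integral K * (- (1 powr (e + 1)) / (e + 1))) {1..}"
    by (intro has_integral_mult_right has_integral_powr_to_inf e) auto
  note f = remainder_M_has_integral[OF assms(1-3)]
  have "norm (remainder_M N a z / 2) \<le> K * (- (1 powr (e + 1)) / (e + 1))"
    unfolding integral_unique[OF f, symmetric] integral_unique[OF g, symmetric]
  proof (rule integral_norm_bound_integral)
    fix s :: real assume "s \<in> {1..}"
    then show "norm (of_real s powr (2 * a - 2) * remainder_g N a (z * of_real s)) \<le> K * s powr e"
      unfolding K_def e_def using S by (intro remainder_g_bound_on_ray assms(1)) auto
  qed (use f g in \<open>auto simp: integrable_on_def\<close>)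
  also have "K * (- (1 powr (e + 1)) / (e + 1)) = K / d / 2"
    unfolding e(2) by simp
  finally show ?thesis by (simp add: K_def norm_divide mult_ac flip: d_def)
qed

section \<open>The terminant on the positive real axis\<close>

text \<open>
  The derivative of \<open>y cos(t - c) - y' sin(t - c)\<close> is \<open>- q sin(t - c)\<close>, whose sign oscillates over a
  period; adding \<open>q (1 - cos(t - c))\<close> amounts to an integration by parts and leaves the derivative
  \<open>q' (1 - cos(t - c))\<close>, which has the sign of \<open>q'\<close>. At both ends of the period the corrected
  expression is the value of \<open>y\<close>.
\<close>

lemma
  fixes y y' q q' :: "real \<Rightarrow> real"
  assumes y: "\<And>t. t \<ge> c \<Longrightarrow> (y has_real_derivative y' t) (at t)"
    and y': "\<And>t. t \<ge> c \<Longrightarrow> (y' has_real_derivative q t - y t) (at t)"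
    and q: "\<And>t. t \<ge> c \<Longrightarrow> (q has_real_derivative q' t) (at t)"
  shows oscillator_period_le: "(\<And>t. t \<ge> c \<Longrightarrow> q' t \<le> 0) \<Longrightarrow> y (c + 2 * pi) \<le> y c"
    and oscillator_period_less: "(\<And>t. t \<ge> c \<Longrightarrow> q' t < 0) \<Longrightarrow> y (c + 2 * pi) < y c"
proof -
  define V where "V t = y t * cos (t - c) - y' t * sin (t - c) + q t * (1 - cos (t - c))" for t
  have V: "(V has_real_derivative q' t * (1 - cos (t - c))) (at t)" if "t \<ge> c" for t
    unfolding V_def
    by (rule derivative_eq_intros y[OF that] y'[OF that] q[OF that] refl)+ (simp add: algebra_simps)
  have cont: "continuous_on {c..c + 2 * pi} V"
    by (intro continuous_at_imp_continuous_on ballI DERIV_isCont[OF V]) auto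
  have V_ends: "V c = y c" "V (c + 2 * pi) = y (c + 2 * pi)"
    by (simp_all add: V_def)
  show "y (c + 2 * pi) \<le> y c" if "\<And>t. t \<ge> c \<Longrightarrow> q' t \<le> 0"
    unfolding V_ends[symmetric]
  proof (rule DERIV_nonpos_imp_decreasing_open[OF _ _ cont])
    fix t assume "c < t"
    then show "\<exists>d. (V has_real_derivative d) (at t) \<and> d \<le> 0"
      using V[of t] that[of t] by (intro exI[of _ "q' t * (1 - cos (t - c))"]) (auto intro: mult_nonpos_nonneg)
  qed simp
  show "y (c + 2 * pi) < y c" if "\<And>t. t \<ge> c \<Longrightarrow> q' t < 0"
    unfolding V_ends[symmetric]
  proof (rule DERIV_neg_imp_decreasing_open[OF _ _ cont])
    fix t assume t: "c < t" "t < c + 2 * pi"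
    have "sin ((t - c) / 2) > 0" using t by (intro sin_gt_zero) auto
    moreover have "cos (t - c) = 1 - 2 * (sin ((t - c) / 2))\<^sup>2"
      by (rule trans[OF arg_cong[of _ _ cos] cos_double_sin]) simp
    ultimately have "1 - cos (t - c) > 0" by simp
    then show "\<exists>d. (V has_real_derivative d) (at t) \<and> d < 0"
      using V[of t] that[of t] t by (intro exI[of _ "q' t * (1 - cos (t - c))"]) (auto intro: mult_neg_pos)
  qed simp
qed

text \<open>
  The values of \<open>y\<close> decrease from period to period towards the limit \<open>0\<close>.
\<close>

lemma
  fixes y y' q q' :: "real \<Rightarrow> real"
  assumes y: "\<And>t. t \<ge> c \<Longrightarrow> (y has_real_derivative y' t) (at t)"
    and y': "\<And>t. t \<ge> c \<Longrightarrow> (y' has_real_derivative q t - y t) (at t)"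
    and q: "\<And>t. t \<ge> c \<Longrightarrow> (q has_real_derivative q' t) (at t)"
    and lim: "(y \<longlongrightarrow> 0) at_top"
  shows decaying_oscillator_nonneg: "(\<And>t. t \<ge> c \<Longrightarrow> q' t \<le> 0) \<Longrightarrow> 0 \<le> y c"
    and decaying_oscillator_pos: "(\<And>t. t \<ge> c \<Longrightarrow> q' t < 0) \<Longrightarrow> 0 < y c"
proof -
  have nonneg: "0 \<le> y b" if b: "b \<ge> c" and q': "\<And>t. t \<ge> c \<Longrightarrow> q' t \<le> 0" for b
  proof -
    have step: "y (t + 2 * pi) \<le> y t" if "t \<ge> c" for t
      by (rule oscillator_period_le[of t y y' q q']) (use that y y' q q' in auto)
    have "y (b + real n * (2 * pi)) \<le> y b" for n
    proof (induction n)
      case (Suc n)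
      have "y (b + real n * (2 * pi) + 2 * pi) \<le> y (b + real n * (2 * pi))"
        using b by (intro step) (simp add: add_increasing2)
      with Suc.IH show ?case by (simp add: algebra_simps)
    qed simp
    moreover have "filterlim (\<lambda>n. b + real n * (2 * pi)) at_top sequentially"
      by (intro filterlim_tendsto_add_at_top[OF tendsto_const] filterlim_at_top_mult_tendsto_pos[OF tendsto_const])
        (simp_all add: filterlim_real_sequentially)
    then have "(\<lambda>n. y (b + real n * (2 * pi))) \<longlonglongrightarrow> 0"
      by (rule filterlim_compose[OF lim])
    ultimately show ?thesis
      using tendsto_upperbound[of "\<lambda>n. y (b + real n * (2 * pi))" 0 sequentially "y b"] by simp
  qed
  show "0 \<le> y c" if "\<And>t. t \<ge> c \<Longrightarrow> q' t \<le> 0"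
    using nonneg[of c] that by simp
  show "0 < y c" if q': "\<And>t. t \<ge> c \<Longrightarrow> q' t < 0"
  proof -
    have "0 \<le> y (c + 2 * pi)" using q' by (intro nonneg) (auto intro: less_imp_le)
    also have "\<dots> < y c" using oscillator_period_less[OF y y' q q'] by simp
    finally show ?thesis .
  qed
qed

text \<open>
  On the positive real axis \<open>y(t) = f(1-p,t)\<close> satisfies \<open>y'' + y = t\<^bsup>-p\<^esup>\<close> and tends to \<open>0\<close>. The
  right-hand side is real and decreasing, so the real part of \<open>y\<close> is positive. The imaginary part and its
  negative solve the homogeneous equation, hence both are nonnegative.
\<close>

lemma
  fixes p x :: real
  assumes "p > 0" "x > 0"
  shows terminant_real: "terminant (of_real p) (of_real x) \<in> \<real>"
    and terminant_pos: "Re (terminant (of_real p) (of_real x)) > 0"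
proof -
  let ?f = "\<lambda>t. aux_f (1 - of_real p) (of_real t)" and ?g = "\<lambda>t. aux_g (1 - of_real p) (of_real t)"
  have f: "(?f has_vector_derivative - ?g t) (at t)"
    and g: "(?g has_vector_derivative ?f t - of_real (t powr - p)) (at t)" if t: "t \<ge> x" for t
  proof -
    have "complex_of_real t powr (1 - of_real p) / of_real t = of_real (t powr - p)"
      using t assms(2) powr_add[of t 1 "- p"] powr_of_real[of t "1 - p"] by simp
    then show "(?f has_vector_derivative - ?g t) (at t)" "(?g has_vector_derivative ?f t - of_real (t powr - p)) (at t)"
      using aux_f_ray_has_vector_derivative[of 1 t "1 - of_real p"] aux_g_ray_has_vector_derivative[of 1 t "1 - of_real p"] t assms(2)
      by simp_all
  qed
  have lim: "(?f \<longlongrightarrow> 0) at_top"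
  proof -
    obtain C where C: "norm (terminant (of_real p) (1 * of_real s)) \<le> C" if "s \<ge> 1" for s
      using terminant_bounded_on_ray[of 1 "of_real p"] by auto
    have "((\<lambda>s. s powr - p) \<longlongrightarrow> 0) at_top"
      using assms(1) by (intro tendsto_neg_powr filterlim_ident) simp
    from tendsto_mult[OF tendsto_const this, of C] have "((\<lambda>s. C * s powr - p) \<longlongrightarrow> 0) at_top" by simp
    moreover have "\<forall>\<^sub>F s in at_top. norm (?f s) \<le> C * s powr - p"
      using eventually_ge_at_top[of 1]
    proof eventually_elim
      fix s :: real assume s: "s \<ge> 1"
      have "s powr p * norm (?f s) \<le> C"
        using C[OF s] s by (simp add: terminant_def norm_mult norm_powr_real_powr)
      then show "norm (?f s) \<le> C * s powr - p"
        using s by (simp add: powr_minus field_simps)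
    qed
    ultimately show ?thesis by (rule Lim_null_comparison[rotated])
  qed
  have Re_f: "((\<lambda>t. Re (?f t)) has_real_derivative - Re (?g t)) (at t)"
    and Re_g: "((\<lambda>t. - Re (?g t)) has_real_derivative t powr - p - Re (?f t)) (at t)"
    and Im_f: "((\<lambda>t. Im (?f t)) has_real_derivative - Im (?g t)) (at t)"
    and Im_g: "((\<lambda>t. - Im (?g t)) has_real_derivative 0 - Im (?f t)) (at t)" if "t \<ge> x" for t
    using has_vector_derivative_minus[OF bounded_linear.has_vector_derivative[OF bounded_linear_Re g[OF that]]]
      has_vector_derivative_minus[OF bounded_linear.has_vector_derivative[OF bounded_linear_Im g[OF that]]]
      bounded_linear.has_vector_derivative[OF bounded_linear_Re f[OF that]]
      bounded_linear.has_vector_derivative[OF bounded_linear_Im f[OF that]]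
    by (simp_all add: has_real_derivative_iff_has_vector_derivative)
  have Re_pos: "0 < Re (?f x)"
  proof (rule decaying_oscillator_pos[OF Re_f Re_g])
    show "((\<lambda>t. t powr - p) has_real_derivative - p * t powr (- p - 1)) (at t)" if "t \<ge> x" for t
      using that assms by (auto intro!: derivative_eq_intros)
    show "((\<lambda>t. Re (?f t)) \<longlongrightarrow> 0) at_top"
      using tendsto_Re[OF lim] by simp
    show "- p * t powr (- p - 1) < 0" if "t \<ge> x" for t
      using that assms by simp
  qed
  have "0 \<le> Im (?f x)"
  proof (rule decaying_oscillator_nonneg[OF Im_f Im_g])
    show "((\<lambda>t. 0) has_real_derivative 0) (at t)" for t :: real by simp
    show "((\<lambda>t. Im (?f t)) \<longlongrightarrow> 0) at_top" using tendsto_Im[OF lim] by simp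
  qed simp_all
  moreover have "0 \<le> - Im (?f x)"
  proof (rule decaying_oscillator_nonneg[where c = x and y = "\<lambda>t. - Im (?f t)" and y' = "\<lambda>t. Im (?g t)" and q = "\<lambda>t. 0" and q' = "\<lambda>t. 0"])
    show "((\<lambda>t. - Im (?f t)) has_real_derivative Im (?g t)) (at t)"
      "((\<lambda>t. Im (?g t)) has_real_derivative 0 - - Im (?f t)) (at t)" if "t \<ge> x" for t
      using DERIV_minus[OF Im_f[OF that]] DERIV_minus[OF Im_g[OF that]] by simp_all
    show "((\<lambda>t. 0) has_real_derivative 0) (at t)" for t :: real by simp
    show "((\<lambda>t. - Im (?f t)) \<longlongrightarrow> 0) at_top" using tendsto_minus[OF tendsto_Im[OF lim]] by simp
  qed simp_all
  ultimately have "?f x = of_real (Re (?f x))"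
    by (simp add: complex_eq_iff)
  moreover have "complex_of_real x powr of_real p = of_real (x powr p)"
    using assms(2) by (intro powr_of_real) simp
  ultimately have eq: "terminant (of_real p) (of_real x) = of_real (x powr p * Re (?f x))"
    by (metis of_real_mult terminant_def)
  show "terminant (of_real p) (of_real x) \<in> \<real>" unfolding eq by (rule Reals_of_real)
  show "Re (terminant (of_real p) (of_real x)) > 0" unfolding eq using assms Re_pos by simp
qed

text \<open>
  By the recurrence \<open>1 - \<Pi>\<^sub>p\<close> is a positive multiple of \<open>\<Pi>\<^bsub>p+2\<^esub>\<close>.
\<close>

lemma terminant_less_1:
  fixes p x :: real
  assumes "p > 0" "x > 0"
  shows "Re (terminant (of_real p) (of_real x)) < 1"
proof -
  have "terminant (of_real p) (of_real x) = 1 - of_real (p * (p + 1) / x\<^sup>2) * terminant (of_real (p + 2)) (of_real x)"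
    using terminant_rec[of "of_real x" "of_real p"] assms(2) by simp
  then have "Re (terminant (of_real p) (of_real x)) = 1 - p * (p + 1) / x\<^sup>2 * Re (terminant (of_real (p + 2)) (of_real x))"
    by (simp only: minus_complex.sel one_complex.sel Re_complex_of_real Im_complex_of_real times_complex.sel mult_zero_left diff_zero)
  moreover have "p * (p + 1) / x\<^sup>2 * Re (terminant (of_real (p + 2)) (of_real x)) > 0"
    using assms terminant_pos[of "p + 2" x] by (intro mult_pos_pos divide_pos_pos) auto
  ultimately show ?thesis by simp
qed

section \<open>The remainder of the squared modulus\<close>

text \<open>
  The integral representation turns the bounds \<open>0 < \<Pi> < 1\<close> into a factor \<open>\<theta>\<close> in \<open>(0, 1]\<close>
  in front of the first omitted term. This also covers the case of a vanishing term.
\<close>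

lemma remainder_M_real:
  fixes x \<alpha> :: real
  assumes "x > 0" "\<alpha> < real N + 1"
  obtains \<theta> where "0 < \<theta>" "\<theta> \<le> 1"
    "remainder_M N (of_real \<alpha>) (of_real x) =
      of_real (\<theta> * ((-1) ^ N * (pochhammer (1 - \<alpha>) (2 * N + 1) / (real N + 1 - \<alpha>)) * (1 / x ^ (2 * N + 1))))"
proof -
  define p where "p = real (2 * N + 2) - \<alpha>"
  define e where "e = 2 * \<alpha> - real (2 * N + 3)"
  define K where "K = (-1) ^ N * pochhammer (1 - \<alpha>) (2 * N + 1) / x ^ (2 * N + 1)"
  define \<phi> where "\<phi> s = Re (terminant (of_real p) (of_real (x * s)))" for s
  have p: "p > 0" and e: "e < -1" using assms(2) by (simp_all add: p_def e_def)
  have term_eq: "terminant (of_real p) (of_real x * of_real s) = of_real (\<phi> s)" if "s \<ge> 1" for s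
    using terminant_real[of p "x * s"] p assms(1) that by (simp add: \<phi>_def)
  have "continuous_on {1..} \<phi>"
  proof -
    have "continuous_on {0<..} (\<lambda>s. terminant (of_real p) (of_real x * of_real s))"
      using assms(1) by (intro terminant_continuous_on_ray) auto
    then have "continuous_on {1..} (\<lambda>s. Re (terminant (of_real p) (of_real x * of_real s)))"
      by (intro continuous_intros) (auto elim: continuous_on_subset)
    then show ?thesis by (simp add: \<phi>_def[abs_def])
  qed
  moreover have "0 < \<phi> s" "\<phi> s \<le> 1" if "s \<ge> 1" for s
    using terminant_pos[OF p, of "x * s"] terminant_less_1[OF p, of "x * s"] assms(1) that by (auto simp: \<phi>_def)
  ultimately obtain I where I: "I > 0" "I \<le> 1 / (- e - 1)" "((\<lambda>s. s powr e * \<phi> s) has_integral I) {1..}"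
    using weighted_powr_integral_bounds[of \<phi> e] e by blast
  have "((\<lambda>s. complex_of_real (K * (s powr e * \<phi> s))) has_integral of_real (K * I)) {1..}"
    using has_integral_linear[OF has_integral_mult_right[OF I(3), of K] bounded_linear_of_real] by (simp add: o_def)
  moreover have "complex_of_real (K * (s powr e * \<phi> s)) =
      of_real s powr (2 * of_real \<alpha> - 2) * remainder_g N (of_real \<alpha>) (of_real x * of_real s)" if s: "s \<in> {1..}" for s
  proof -
    have s': "s > 0" using s by simp
    have p': "of_nat (2 * N + 2) - complex_of_real \<alpha> = of_real p" by (simp add: p_def)
    have "s powr e = s powr ((2 * \<alpha> - 2) - real (2 * N + 1))"
      by (rule arg_cong) (simp add: e_def)
    also have "\<dots> = s powr (2 * \<alpha> - 2) / s ^ (2 * N + 1)"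
      using s' by (simp only: powr_diff powr_realpow)
    finally have "complex_of_real (s powr e) = of_real s powr (2 * of_real \<alpha> - 2) / of_real s ^ (2 * N + 1)"
      using s powr_of_real[of s "2 * \<alpha> - 2"] by simp
    moreover have "complex_of_real K = (-1) ^ N * pochhammer (1 - of_real \<alpha>) (2 * N + 1) / of_real x ^ (2 * N + 1)"
      using pochhammer_of_real[of "1 - \<alpha>" "2 * N + 1", where 'a = complex] by (simp add: K_def)
    moreover have "remainder_g N (of_real \<alpha>) (of_real x * of_real s) =
      (-1) ^ N * (pochhammer (1 - of_real \<alpha>) (2 * N + 1) / (of_real x * of_real s) ^ (2 * N + 1)) * of_real (\<phi> s)"
    proof -
      have nz: "complex_of_real x * of_real s \<noteq> 0"
        using assms(1) s' by simp
      show ?thesis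
        unfolding remainder_g_eq_terminant[OF nz] p' using term_eq[of s] s by simp
    qed
    ultimately show ?thesis
      by (simp only: of_real_mult) (simp add: power_mult_distrib mult_ac)
  qed
  ultimately have "((\<lambda>s. of_real s powr (2 * of_real \<alpha> - 2) * remainder_g N (of_real \<alpha>) (of_real x * of_real s))
      has_integral of_real (K * I)) {1..}"
    by (rule has_integral_eq[rotated])
  moreover have "((\<lambda>s. of_real s powr (2 * of_real \<alpha> - 2) * remainder_g N (of_real \<alpha>) (of_real x * of_real s))
      has_integral remainder_M N (of_real \<alpha>) (of_real x) / 2) {1..}"
    using assms by (intro remainder_M_has_integral) (auto simp: Arg_of_real)
  ultimately have "of_real (K * I) = remainder_M N (of_real \<alpha>) (of_real x) / 2"
    by (rule has_integral_unique)
  then have R: "remainder_M N (of_real \<alpha>) (of_real x) = of_real (2 * (K * I))"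
    by (simp add: mult_ac)
  define d where "d = real N + 1 - \<alpha>"
  have d: "d > 0" "- e - 1 = 2 * d" using assms(2) by (simp_all add: d_def e_def)
  \<comment> \<open>The bound \<open>I \<le> 1 / (2 * d)\<close> makes \<open>2 * d * I\<close> at most \<open>1\<close>.\<close>
  show ?thesis
  proof (rule that[of "2 * d * I"])
    show "0 < 2 * d * I" using d I by simp
    show "2 * d * I \<le> 1" using I(2) d by (simp add: field_simps)
    show "remainder_M N (of_real \<alpha>) (of_real x) = of_real (2 * d * I *
        ((-1) ^ N * (pochhammer (1 - \<alpha>) (2 * N + 1) / (real N + 1 - \<alpha>)) * (1 / x ^ (2 * N + 1))))"
      unfolding R d_def[symmetric] using d by (simp add: K_def)
  qed
qed

theorem theorem1p2:
  fixes a z :: complex and N :: nat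
  assumes "z \<noteq> 0" and "\<bar>Arg z\<bar> < pi" and "real N + 1 > Re a"
  shows "((\<lambda>s. of_real s powr (2 * a - 2) * remainder_g N a (z * of_real s)) integrable_on {1..}
          \<and> remainder_M N a z =
              2 * integral {1..} (\<lambda>s. of_real s powr (2 * a - 2) * remainder_g N a (z * of_real s)))
    \<and> ereal (norm (remainder_M N a z)) \<le>
        ereal (norm (pochhammer (1 - a) (2 * N + 1)) / (real N + 1 - Re a) * (1 / norm z ^ (2 * N + 1)))
        * (SUP r\<in>{1::real..}. ereal (norm (terminant (of_nat (2 * N + 2) - a) (z * of_real r))))
    \<and> (\<forall>x \<alpha> :: real. z = of_real x \<longrightarrow> x > 0 \<longrightarrow> a = of_real \<alpha> \<longrightarrow>
        (let T = (-1) ^ N * (pochhammer (1 - \<alpha>) (2 * N + 1) / (real N + 1 - \<alpha>)) * (1 / x ^ (2 * N + 1))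
         in remainder_M N a z \<in> \<real>
            \<and> \<bar>Re (remainder_M N a z)\<bar> \<le> \<bar>T\<bar>
            \<and> sgn (Re (remainder_M N a z)) = sgn T))"
proof (intro conjI allI impI)
  note int = remainder_M_has_integral[OF assms]
  show "(\<lambda>s. of_real s powr (2 * a - 2) * remainder_g N a (z * of_real s)) integrable_on {1..}"
    using int by blast
  show "remainder_M N a z = 2 * integral {1..} (\<lambda>s. of_real s powr (2 * a - 2) * remainder_g N a (z * of_real s))"
    unfolding integral_unique[OF int] by simp
next
  let ?t = "\<lambda>r. norm (terminant (of_nat (2 * N + 2) - a) (z * of_real r))"
  define S where "S = (SUP r\<in>{1::real..}. ereal (?t r))"
  obtain C where C: "\<And>r. r \<ge> 1 \<Longrightarrow> ?t r \<le> C"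
    using terminant_bounded_on_ray[OF assms(1,2)] by blast
  have le_S: "ereal (?t r) \<le> S" if "r \<ge> 1" for r
    unfolding S_def using that by (intro SUP_upper) auto
  have "S \<le> ereal C"
    unfolding S_def using C by (intro SUP_least) auto
  moreover have "ereal 0 \<le> S"
    using le_S[of 1] by (rule order_trans[rotated]) auto
  ultimately obtain s where s: "S = ereal s" by (cases S) auto
  have "ereal (norm (remainder_M N a z)) \<le>
      ereal (norm (pochhammer (1 - a) (2 * N + 1)) / (real N + 1 - Re a) * (1 / norm z ^ (2 * N + 1))) * S"
    unfolding s times_ereal.simps ereal_less_eq
    using le_S s by (intro remainder_M_norm_bound[OF assms]) simp
  then show "ereal (norm (remainder_M N a z)) \<le>
      ereal (norm (pochhammer (1 - a) (2 * N + 1)) / (real N + 1 - Re a) * (1 / norm z ^ (2 * N + 1)))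
      * (SUP r\<in>{1::real..}. ereal (?t r))"
    unfolding S_def .
next
  fix x \<alpha> :: real
  assume x: "z = of_real x" "x > 0" and \<alpha>: "a = of_real \<alpha>"
  define T where "T = (-1) ^ N * (pochhammer (1 - \<alpha>) (2 * N + 1) / (real N + 1 - \<alpha>)) * (1 / x ^ (2 * N + 1))"
  have "\<alpha> < real N + 1" using assms(3) \<alpha> by simp
  from remainder_M_real[OF x(2) this] obtain \<theta> where "0 < \<theta>" "\<theta> \<le> 1" "remainder_M N a z = of_real (\<theta> * T)"
    unfolding T_def x(1) \<alpha> by blast
  then have "remainder_M N a z \<in> \<real> \<and> \<bar>Re (remainder_M N a z)\<bar> \<le> \<bar>T\<bar> \<and> sgn (Re (remainder_M N a z)) = sgn T"
    by (simp add: sgn_mult abs_mult mult_left_le_one_le)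
  then show "let T = (-1) ^ N * (pochhammer (1 - \<alpha>) (2 * N + 1) / (real N + 1 - \<alpha>)) * (1 / x ^ (2 * N + 1))
         in remainder_M N a z \<in> \<real> \<and> \<bar>Re (remainder_M N a z)\<bar> \<le> \<bar>T\<bar> \<and> sgn (Re (remainder_M N a z)) = sgn T"
    unfolding Let_def T_def .
qed

end
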